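(* Let $\mathbb{A}=\{\mathbf{a}_1,\dots,\mathbf{a}_d\}$ be a linearly independent set of vectors in $\mathbb{R}^d$, let $A$ be the $d\times d$ real matrix whose $k$-th row is $\mathbf{a}_k^\top$, let $S=\mathcal{D}'_{\mathbb{A}}(\mathbb{R}^{d+1})$, and let $p\in\mathbb{C}[X_1,\dots,X_d,T]$. Then $N_S(p)=\{0\}$ if and only if for every $\mathbf{v}\in A^{-1}2\pi\mathbb{Z}^d$ there exists $t\in\mathbb{C}$ such that $p(i\mathbf{v},t)\neq 0$.
   Context: For $\mathbf{a}\in\mathbb{R}^d$ the translation $\mathbf{S}_{\mathbf{a}}$ on $\mathcal{D}'(\mathbb{R}^d)$ is $\langle\mathbf{S}_{\mathbf{a}}T,\varphi\rangle=\langle T,\varphi(\cdot+\mathbf{a})\rangle$, and $\mathcal{D}'_{\mathbb{A}}(\mathbb{R}^d)=\{T\in\mathcal{D}'(\mathbb{R}^d):\mathbf{S}_{\mathbf{a}_k}T=T,\ k=1,\dots,d\}$. For $u\in\mathcal{D}'(\mathbb{R}^{d+1})$ (coordinates $(\mathbf{x},t)$), let $\vec{u}:\mathcal{D}(\mathbb{R})\to\mathcal{D}'(\mathbb{R}^d)$ be given by $\langle\vec{u}(\varphi),\psi\rangle=\langle u,\psi\otimes\varphi\rangle$ for $\varphi\in\mathcal{D}(\mathbb{R})$, $\psi\in\mathcal{D}(\mathbb{R}^d)$. Then $\mathcal{D}'_{\mathbb{A}}(\mathbb{R}^{d+1})=\{u\in\mathcal{D}'(\mathbb{R}^{d+1}):\vec{u}(\varphi)\in\mathcal{D}'_{\mathbb{A}}(\mathbb{R}^d)\text{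 for all }\varphi\in\mathcal{D}(\mathbb{R})\}$. $D_p=p\left(\frac{\partial}{\partial x_1},\dots,\frac{\partial}{\partial x_d},\frac{\partial}{\partial t}\right)$; $N_S(p)=\{u\in S: D_pu=0,\ u|_{t<0}=0\}$, where $u|_{t<0}$ is the restriction to $\{t<0\}$. *)

theory Defs
  imports "HOL-Analysis.Analysis" "HOL-Library.Poly_Mapping"
begin

definition dirderiv :: "'a::euclidean_space \<Rightarrow> ('a \<Rightarrow> complex) \<Rightarrow> 'a \<Rightarrow> complex" where
  "dirderiv v f x = vector_derivative (\<lambda>s::real. f (x + s *\<^sub>R v)) (at 0)"

fun iterpd :: "'a::euclidean_space list \<Rightarrow> ('a \<Rightarrow> complex) \<Rightarrow> 'a \<Rightarrow> complex" where
  "iterpd [] f = f"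
| "iterpd (v # vs) f = dirderiv v (iterpd vs f)"

definition smooth_fun :: "('a::euclidean_space \<Rightarrow> complex) \<Rightarrow> bool" where
  "smooth_fun f \<longleftrightarrow> (\<forall>vs. set vs \<subseteq> Basis \<longrightarrow>
      continuous_on UNIV (iterpd vs f) \<and>
      (\<forall>v\<in>Basis. \<forall>x. (\<lambda>s::real. iterpd vs f (x + s *\<^sub>R v)) differentiable (at 0)))"

definition test_fun :: "('a::euclidean_space \<Rightarrow> complex) \<Rightarrow> bool" where
  "test_fun f \<longleftrightarrow> smooth_fun f \<and> compact (closure {x. f x \<noteq> 0})"

definition D_conv0 :: "(nat \<Rightarrow> 'a::euclidean_space \<Rightarrow> complex) \<Rightarrow> bool" where
  "D_conv0 \<phi> \<longleftrightarrow> (\<forall>k. test_fun (\<phi> k)) \<and>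
     (\<exists>K. compact K \<and> (\<forall>k x. x \<notin> K \<longrightarrow> \<phi> k x = 0)) \<and>
     (\<forall>vs. set vs \<subseteq> Basis \<longrightarrow> uniform_limit UNIV (\<lambda>k. iterpd vs (\<phi> k)) (\<lambda>_. 0) sequentially)"

text \<open>Distributions: (sequentially) continuous linear functionals on D; normalised to
  take the value 0 on non-test functions so that equality of distributions is equality of
  functions.\<close>
definition distribution :: "(('a::euclidean_space \<Rightarrow> complex) \<Rightarrow> complex) \<Rightarrow> bool" where
  "distribution T \<longleftrightarrow>
     (\<forall>f. \<not> test_fun f \<longrightarrow> T f = 0) \<and>
     (\<forall>f g. test_fun f \<longrightarrow> test_fun g \<longrightarrow> T (\<lambda>x. f x + g x) = T f + T g) \<and>
     (\<forall>c f. test_fun f \<longrightarrow> T (\<lambda>x. c * f x) = c * T f) \<and>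
     (\<forall>\<phi>. D_conv0 \<phi> \<longrightarrow> (\<lambda>k. T (\<phi> k)) \<longlonglongrightarrow> 0)"

type_synonym 'n dist_xt = "(((real^'n) \<times> real) \<Rightarrow> complex) \<Rightarrow> complex"

definition periodic_dist :: "('n::finite \<Rightarrow> real^'n) \<Rightarrow> 'n dist_xt \<Rightarrow> bool" where
  "periodic_dist a u \<longleftrightarrow> distribution u \<and>
     (\<forall>\<psi> :: real^'n \<Rightarrow> complex. \<forall>\<phi> :: real \<Rightarrow> complex. \<forall>k.
        test_fun \<psi> \<longrightarrow> test_fun \<phi> \<longrightarrow>
        u (\<lambda>(x, t). \<psi> (x + a k) * \<phi> t) = u (\<lambda>(x, t). \<psi> x * \<phi> t))"

text \<open>Polynomials in d+1 variables X_1..X_d, T: finitely supported maps from exponents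
  (alpha, j) (monomial X^alpha T^j) to complex coefficients.\<close>
type_synonym 'n cpoly = "(('n \<Rightarrow> nat) \<times> nat) \<Rightarrow>\<^sub>0 complex"

definition peval :: "'n::finite cpoly \<Rightarrow> complex^'n \<Rightarrow> complex \<Rightarrow> complex" where
  "peval p z t = (\<Sum>\<alpha>\<in>Poly_Mapping.keys p. Poly_Mapping.lookup p \<alpha> * (\<Prod>k\<in>UNIV. (z $ k) ^ fst \<alpha> k) * t ^ snd \<alpha>)"

definition pderiv_xt :: "(('n::finite \<Rightarrow> nat) \<times> nat) \<Rightarrow> (((real^'n) \<times> real) \<Rightarrow> complex) \<Rightarrow> ((real^'n) \<times> real) \<Rightarrow> complex" where
  "pderiv_xt \<alpha> f = iterpd
     (replicate (snd \<alpha>) (0, 1) @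
      concat (map (\<lambda>k. replicate (fst \<alpha> k) (axis k 1, 0)) (SOME xs. distinct xs \<and> set xs = (UNIV :: 'n set))))
     f"

text \<open>D_p u = sum_alpha c_alpha d^alpha u, with distributional derivatives
  \<langle>d^alpha u, phi\<rangle> = (-1)^|alpha| \<langle>u, d^alpha phi\<rangle>.\<close>
definition Dp :: "'n::finite cpoly \<Rightarrow> 'n dist_xt \<Rightarrow> 'n dist_xt" where
  "Dp p u = (\<lambda>\<phi>. if test_fun \<phi> then
      (\<Sum>\<alpha>\<in>Poly_Mapping.keys p. Poly_Mapping.lookup p \<alpha> * (-1) ^ (sum (fst \<alpha>) UNIV + snd \<alpha>) * u (pderiv_xt \<alpha> \<phi>))
    else 0)"

definition vanishes_neg_time :: "'n::finite dist_xt \<Rightarrow> bool" where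
  "vanishes_neg_time u \<longleftrightarrow> (\<forall>\<phi>. test_fun \<phi> \<and> closure {y. \<phi> y \<noteq> 0} \<subseteq> {(x, t). t < 0} \<longrightarrow> u \<phi> = 0)"

definition N_S :: "('n::finite \<Rightarrow> real^'n) \<Rightarrow> 'n cpoly \<Rightarrow> 'n dist_xt set" where
  "N_S a p = {u. periodic_dist a u \<and> Dp p u = (\<lambda>_. 0) \<and> vanishes_neg_time u}"

end

theory Submission
  imports Defs "HOL-Computational_Algebra.Fundamental_Theorem_Algebra"
begin

text \<open>If \<open>p(iv, \<cdot>)\<close> vanishes identically for a frequency \<open>v\<close> of the dual lattice, then the product of
  the character \<open>exp(iv\<cdot>x)\<close> with the Dirac distribution at time 0 is a nonzero element of the kernel.
  Conversely, regularising \<open>u\<close> in the kernel by a tensor product of test functions gives a smooth function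
  \<open>g\<close> that is periodic in space, vanishes for large times (the regularisation reflects time) and satisfies
  \<open>p(-\<partial>) g = 0\<close>. Averaging \<open>g\<close> against characters reduces to the case where \<open>g\<close> is itself a character
  in space; then it solves an ordinary differential equation with nonzero characteristic polynomial,
  hence vanishes. So \<open>u\<close> annihilates all tensor products, which are dense.\<close>

section \<open>Smooth functions and test functions\<close>

text \<open>Each spatial mode obeys its own ODE in time, and uniqueness for that ODE holds whatever
  its roots and leading coefficient are. So no estimate uniform in the frequency is needed, and no
  Fourier series is ever summed: it is enough that a continuous function with vanishing coefficients
  vanishes. Regularising by tensor products is forced, because spatial periodicity of
  \<open>u\<close> is postulated on tensor products only. The frequencies come from
  \<open>A v = 2 pi m\<close>, which says that \<open>v\<close> pairs with each \<open>a k\<close>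
  to a multiple of \<open>2 pi\<close>, so that \<open>exp(iv.x)\<close> has all periods
  \<open>a k\<close>. If \<open>p(iv, .)\<close> is identically 0, the operator kills the product of
  this character with any distribution in time; the Dirac distribution at 0 is one that does not see
  negative times. Two features of the definitions shape the rest. Smoothness is stated through
  iterated coordinate derivatives, so symmetry of mixed derivatives has to be established; it is
  used to differentiate regularisations and to reorder \<open>pderiv_xt\<close>. Distributions are
  sequentially continuous, so every limit is taken along a sequence of test functions supported in
  one ball.\<close>

definition has_dirderiv :: "'a::euclidean_space \<Rightarrow> ('a \<Rightarrow> complex) \<Rightarrow> ('a \<Rightarrow> complex) \<Rightarrow> bool" where
  "has_dirderiv v f f' \<longleftrightarrow> (\<forall>x. ((\<lambda>s. f (x + s *\<^sub>R v)) has_vector_derivative f' x) (at 0))"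

lemma dirderiv_eq: "has_dirderiv v f f' \<Longrightarrow> dirderiv v f = f'"
  by (auto simp: has_dirderiv_def dirderiv_def vector_derivative_at)

text \<open>The derivative is postulated at parameter 0 but at every base point, so recentring gives
  it along the whole line, in the form that the fundamental theorem of calculus takes.\<close>

lemma has_dirderiv_at:
  assumes "has_dirderiv v f f'"
  shows "((\<lambda>s. f (x + s *\<^sub>R v)) has_vector_derivative f' (x + s *\<^sub>R v)) (at s within S)"
proof -
  have "((\<lambda>r. f ((x + s *\<^sub>R v) + r *\<^sub>R v)) has_vector_derivative f' (x + s *\<^sub>R v)) (at (s - s))"
    using assms by (simp add: has_dirderiv_def)
  then have "(((\<lambda>r. f ((x + s *\<^sub>R v) + r *\<^sub>R v)) \<circ> (\<lambda>r. r - s)) has_vector_derivative 1 *\<^sub>R f' (x + s *\<^sub>R v)) (at s)"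
    by (intro vector_diff_chain_at) (auto intro!: derivative_eq_intros)
  then show ?thesis
    by (auto simp: o_def algebra_simps intro: has_vector_derivative_at_within)
qed

lemma has_dirderiv_add:
  "has_dirderiv v f f' \<Longrightarrow> has_dirderiv v g g' \<Longrightarrow> has_dirderiv v (\<lambda>x. f x + g x) (\<lambda>x. f' x + g' x)"
  by (auto simp: has_dirderiv_def intro!: derivative_intros)

lemma has_dirderiv_mult:
  assumes "has_dirderiv v f f'" "has_dirderiv v g g'"
  shows "has_dirderiv v (\<lambda>x. f x * g x) (\<lambda>x. f' x * g x + f x * g' x)"
  unfolding has_dirderiv_def
proof
  fix x
  have "((\<lambda>s. f (x + s *\<^sub>R v) * g (x + s *\<^sub>R v)) has_vector_derivative
      f (x + 0 *\<^sub>R v) * g' x + f' x * g (x + 0 *\<^sub>R v)) (at 0)"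
    using assms by (intro has_vector_derivative_mult) (auto simp: has_dirderiv_def)
  then show "((\<lambda>s. f (x + s *\<^sub>R v) * g (x + s *\<^sub>R v)) has_vector_derivative f' x * g x + f x * g' x) (at 0)"
    by (simp add: add.commute)
qed

lemma has_dirderiv_const: "has_dirderiv v (\<lambda>_. c) (\<lambda>_. 0)"
  by (auto simp: has_dirderiv_def)

lemma has_dirderiv_cmult: "has_dirderiv v f f' \<Longrightarrow> has_dirderiv v (\<lambda>x. c * f x) (\<lambda>x. c * f' x)"
  using has_dirderiv_mult[OF has_dirderiv_const[of v c]] by simp

lemma has_dirderiv_translate:
  "has_dirderiv v f f' \<Longrightarrow> has_dirderiv v (\<lambda>x. f (x + z)) (\<lambda>x. f' (x + z))"
proof -
  have eq: "x + s *\<^sub>R v + z = (x + z) + s *\<^sub>R v" for x s by (simp add: algebra_simps)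
  show "has_dirderiv v f f' \<Longrightarrow> has_dirderiv v (\<lambda>x. f (x + z)) (\<lambda>x. f' (x + z))"
    unfolding has_dirderiv_def eq by blast
qed

lemma iterpd_append: "iterpd (xs @ ys) f = iterpd xs (iterpd ys f)"
  by (induction xs) auto

lemma smooth_continuous: "smooth_fun f \<Longrightarrow> continuous_on UNIV f"
  unfolding smooth_fun_def by (metis empty_subsetI iterpd.simps(1) list.set(1))

lemma smooth_continuous_compose:
  "smooth_fun f \<Longrightarrow> continuous_on S g \<Longrightarrow> continuous_on S (\<lambda>x. f (g x))"
  by (rule continuous_on_compose2[OF smooth_continuous]) auto

lemma smooth_dirderiv:
  assumes "smooth_fun f" "v \<in> Basis"
  shows "smooth_fun (dirderiv v f)"
  unfolding smooth_fun_def
proof (intro allI impI)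
  fix vs :: "'a list" assume "set vs \<subseteq> Basis"
  then have "set (vs @ [v]) \<subseteq> Basis" using assms by auto
  with assms(1) have "continuous_on UNIV (iterpd (vs @ [v]) f) \<and>
      (\<forall>w\<in>Basis. \<forall>x. (\<lambda>s::real. iterpd (vs @ [v]) f (x + s *\<^sub>R w)) differentiable (at 0))"
    unfolding smooth_fun_def by blast
  then show "continuous_on UNIV (iterpd vs (dirderiv v f)) \<and>
      (\<forall>w\<in>Basis. \<forall>x. (\<lambda>s::real. iterpd vs (dirderiv v f) (x + s *\<^sub>R w)) differentiable (at 0))"
    by (simp add: iterpd_append)
qed

lemma smooth_iterpd: "smooth_fun f \<Longrightarrow> set vs \<subseteq> Basis \<Longrightarrow> smooth_fun (iterpd vs f)"
  by (induction vs) (auto intro: smooth_dirderiv)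

lemma smooth_has_dirderiv:
  assumes "smooth_fun f" "v \<in> Basis"
  shows "has_dirderiv v f (dirderiv v f)"
proof -
  have "(\<lambda>s::real. iterpd [] f (x + s *\<^sub>R v)) differentiable (at 0)" for x
    using assms unfolding smooth_fun_def by (metis empty_subsetI list.set(1))
  then show ?thesis
    by (simp add: has_dirderiv_def dirderiv_def vector_derivative_works[symmetric])
qed

text \<open>\<open>smooth_fun\<close> is the largest class of continuous functions closed under
  coordinate derivatives, so one such class containing \<open>f\<close> suffices. This avoids
  explicit formulas for iterated derivatives.\<close>

lemma smooth_coinduct:
  assumes "P f"
    and cont: "\<And>f. P f \<Longrightarrow> continuous_on UNIV f"
    and deriv: "\<And>f v. P f \<Longrightarrow> v \<in> Basis \<Longrightarrow> \<exists>f'. has_dirderiv v f f' \<and> P f'"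
  shows "smooth_fun f"
proof -
  have P: "P (iterpd vs f)" if "set vs \<subseteq> Basis" for vs
    using that
  proof (induction vs)
    case Nil then show ?case using assms(1) by simp
  next
    case (Cons v vs)
    then have "P (iterpd vs f)" "v \<in> Basis" by auto
    then obtain f' where "has_dirderiv v (iterpd vs f) f'" "P f'" using deriv by blast
    then show ?case using dirderiv_eq by auto
  qed
  have "(\<lambda>s::real. iterpd vs f (x + s *\<^sub>R v)) differentiable (at 0)"
    if vs: "set vs \<subseteq> Basis" "v \<in> Basis" for vs v x
  proof -
    obtain f' where "has_dirderiv v (iterpd vs f) f'" using deriv P vs by blast
    then show ?thesis unfolding has_dirderiv_def using differentiableI_vector by blast
  qed
  then show ?thesis unfolding smooth_fun_def using P cont by blast
qed

lemma smooth_const: "smooth_fun (\<lambda>_. c)"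
  by (rule smooth_coinduct[where P="\<lambda>f. \<exists>c. f = (\<lambda>_. c)"]) (auto intro: has_dirderiv_const)

lemma smooth_add:
  assumes "smooth_fun f" "smooth_fun g"
  shows "smooth_fun (\<lambda>x. f x + g x)"
proof (rule smooth_coinduct[where P="\<lambda>h. \<exists>f g. smooth_fun f \<and> smooth_fun g \<and> h = (\<lambda>x. f x + g x)"])
  show "continuous_on UNIV h" if "\<exists>f g. smooth_fun f \<and> smooth_fun g \<and> h = (\<lambda>x. f x + g x)" for h :: "'a \<Rightarrow> complex"
    using that by (elim exE conjE, hypsubst) (rule continuous_on_add; erule smooth_continuous)
next
  fix h :: "'a \<Rightarrow> complex" and v :: 'a
  assume "\<exists>f g. smooth_fun f \<and> smooth_fun g \<and> h = (\<lambda>x. f x + g x)" and v: "v \<in> Basis"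
  then obtain f g where "smooth_fun f" "smooth_fun g" "h = (\<lambda>x. f x + g x)" by blast
  then show "\<exists>h'. has_dirderiv v h h' \<and> (\<exists>f g. smooth_fun f \<and> smooth_fun g \<and> h' = (\<lambda>x. f x + g x))"
    using v has_dirderiv_add[OF smooth_has_dirderiv smooth_has_dirderiv, of f v g] smooth_dirderiv[of f v] smooth_dirderiv[of g v]
    by blast
qed (use assms in blast)

text \<open>The Leibniz rule leads out of the products but not out of the sums of products, which
  makes this the invariant class for \<open>smooth_mult\<close>.\<close>

inductive sum_of_products :: "('a::euclidean_space \<Rightarrow> complex) \<Rightarrow> bool" where
  prod: "smooth_fun f \<Longrightarrow> smooth_fun g \<Longrightarrow> sum_of_products (\<lambda>x. f x * g x)"
| add: "sum_of_products f \<Longrightarrow> sum_of_products g \<Longrightarrow> sum_of_products (\<lambda>x. f x + g x)"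

lemma smooth_mult:
  assumes "smooth_fun f" "smooth_fun g"
  shows "smooth_fun (\<lambda>x. f x * g x)"
proof (rule smooth_coinduct[where P=sum_of_products])
  show "continuous_on UNIV h" if "sum_of_products h" for h :: "'a \<Rightarrow> complex"
    using that by induction (simp_all add: continuous_on_add continuous_on_mult smooth_continuous)
  show "\<exists>h'. has_dirderiv v h h' \<and> sum_of_products h'" if "sum_of_products h" "v \<in> Basis" for h :: "'a \<Rightarrow> complex" and v
    using that
  proof induction
    case (prod f g)
    then show ?case
      by (intro exI[of _ "\<lambda>x. dirderiv v f x * g x + f x * dirderiv v g x"] conjI has_dirderiv_mult
          sum_of_products.intros smooth_has_dirderiv smooth_dirderiv)
  next
    case (add f g)
    then show ?case using has_dirderiv_add sum_of_products.add by blast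
  qed
qed (use assms sum_of_products.prod in blast)

lemma iterpd_add:
  assumes "smooth_fun f" "smooth_fun g" "set vs \<subseteq> Basis"
  shows "iterpd vs (\<lambda>x. f x + g x) = (\<lambda>x. iterpd vs f x + iterpd vs g x)"
  using assms(3)
  by (induction vs) (auto intro!: dirderiv_eq has_dirderiv_add smooth_has_dirderiv smooth_iterpd assms)

lemma iterpd_cmult:
  assumes "smooth_fun f" "set vs \<subseteq> Basis"
  shows "iterpd vs (\<lambda>x. c * f x) = (\<lambda>x. c * iterpd vs f x)"
  using assms(2)
  by (induction vs) (auto intro!: dirderiv_eq has_dirderiv_cmult smooth_has_dirderiv smooth_iterpd assms)

lemma smooth_cmult: "smooth_fun f \<Longrightarrow> smooth_fun (\<lambda>x. c * f x)"
  by (intro smooth_mult smooth_const)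

lemma smooth_translate:
  assumes "smooth_fun f"
  shows "smooth_fun (\<lambda>x. f (x + z))"
proof (rule smooth_coinduct[where P="\<lambda>h. \<exists>f. smooth_fun f \<and> h = (\<lambda>x. f (x + z))"])
  show "continuous_on UNIV h" if "\<exists>f. smooth_fun f \<and> h = (\<lambda>x. f (x + z))" for h :: "'a \<Rightarrow> complex"
    using that by (elim exE conjE, hypsubst) (erule smooth_continuous_compose, intro continuous_intros)
  show "\<exists>h'. has_dirderiv v h h' \<and> (\<exists>f. smooth_fun f \<and> h' = (\<lambda>x. f (x + z)))"
    if "\<exists>f. smooth_fun f \<and> h = (\<lambda>x. f (x + z))" "v \<in> Basis" for h :: "'a \<Rightarrow> complex" and v
    using that smooth_has_dirderiv smooth_dirderiv has_dirderiv_translate by blast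
qed (use assms in blast)

lemma iterpd_translate:
  assumes "smooth_fun f" "set vs \<subseteq> Basis"
  shows "iterpd vs (\<lambda>x. f (x + z)) = (\<lambda>x. iterpd vs f (x + z))"
  using assms(2)
  by (induction vs) (auto intro!: dirderiv_eq has_dirderiv_translate smooth_has_dirderiv smooth_iterpd assms)

lemma has_dirderiv_pullback:
  assumes "has_dirderiv (L v) f f'" "linear L"
  shows "has_dirderiv v (\<lambda>x. f (L x)) (\<lambda>x. f' (L x))"
  using assms by (auto simp: has_dirderiv_def linear_add linear_scale)

text \<open>Only coordinate derivatives are available, hence \<open>L\<close> has to send coordinate
  directions to coordinate directions or to 0, as projections do.\<close>

lemma smooth_pullback:
  fixes L :: "'a::euclidean_space \<Rightarrow> 'b::euclidean_space"
  assumes "smooth_fun f" "linear L" and L: "\<And>v. v \<in> Basis \<Longrightarrow> L v \<in> insert 0 Basis"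
  shows "smooth_fun (\<lambda>x. f (L x))"
proof (rule smooth_coinduct[where P="\<lambda>h. \<exists>f. smooth_fun f \<and> h = (\<lambda>x. f (L x))"])
  show "continuous_on UNIV h" if "\<exists>f. smooth_fun f \<and> h = (\<lambda>x. f (L x))" for h :: "'a \<Rightarrow> complex"
    using that assms(2)
    by (elim exE conjE) (simp add: smooth_continuous_compose linear_continuous_on linear_conv_bounded_linear)
  show "\<exists>h'. has_dirderiv v h h' \<and> (\<exists>f. smooth_fun f \<and> h' = (\<lambda>x. f (L x)))"
    if h: "\<exists>f. smooth_fun f \<and> h = (\<lambda>x. f (L x))" and v: "v \<in> Basis" for h :: "'a \<Rightarrow> complex" and v
  proof -
    obtain f where f: "smooth_fun f" "h = (\<lambda>x. f (L x))" using h by blast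
    show ?thesis
    proof (cases "L v = 0")
      case True
      then have "has_dirderiv (L v) f (\<lambda>_. 0)" by (simp add: has_dirderiv_def)
      then show ?thesis using f has_dirderiv_pullback[OF _ assms(2)] smooth_const by blast
    next
      case False
      then have "L v \<in> Basis" using L v by auto
      then show ?thesis
        using f has_dirderiv_pullback[OF _ assms(2)] smooth_has_dirderiv smooth_dirderiv by blast
    qed
  qed
qed (use assms in blast)

section \<open>Compact support and test functions\<close>

lemma compact_support_iff:
  fixes f :: "'a::euclidean_space \<Rightarrow> complex"
  shows "compact (closure {x. f x \<noteq> 0}) \<longleftrightarrow> (\<exists>R. \<forall>x. norm x > R \<longrightarrow> f x = 0)"
proof -
  have "compact (closure {x. f x \<noteq> 0}) \<longleftrightarrow> bounded {x. f x \<noteq> 0}"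
    by (simp add: compact_closure)
  also have "\<dots> \<longleftrightarrow> (\<exists>R. \<forall>x. norm x > R \<longrightarrow> f x = 0)"
    unfolding bounded_iff by (metis (mono_tags, lifting) mem_Collect_eq not_le)
  finally show ?thesis .
qed

lemma test_fun_iff: "test_fun f \<longleftrightarrow> smooth_fun f \<and> (\<exists>R. \<forall>x. norm x > R \<longrightarrow> f x = 0)"
  unfolding test_fun_def compact_support_iff ..

text \<open>Differentiation is local: for small parameters the line through \<open>x\<close> stays
  in \<open>U\<close>. This controls the supports of derivatives.\<close>

lemma iterpd_eq_0:
  assumes "open U" "\<And>x. x \<in> U \<Longrightarrow> f x = 0" "x \<in> U"
  shows "iterpd vs f x = 0"
  using assms(3)
proof (induction vs arbitrary: x)
  case Nil then show ?case using assms by simp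
next
  case (Cons v vs)
  have "open ((\<lambda>s. x + s *\<^sub>R v) -` U)"
    by (intro open_vimage assms continuous_intros)
  then have "((\<lambda>s. iterpd vs f (x + s *\<^sub>R v)) has_vector_derivative 0) (at 0)"
    by (rule has_vector_derivative_transform_within_open[OF has_vector_derivative_const[of 0]])
      (use Cons in auto)
  then show ?case by (simp add: dirderiv_def vector_derivative_at)
qed

lemma iterpd_eq_0_norm:
  assumes "\<And>x. norm x > R \<Longrightarrow> f x = 0" "norm x > R"
  shows "iterpd vs f x = 0"
proof (rule iterpd_eq_0[of "{x. norm x > R}"])
  show "open {x::'a. norm x > R}" by (intro open_Collect_less continuous_intros)
qed (use assms in auto)

lemma test_smooth: "test_fun f \<Longrightarrow> smooth_fun f"
  by (simp add: test_fun_def)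

lemma test_iterpd: "test_fun f \<Longrightarrow> set vs \<subseteq> Basis \<Longrightarrow> test_fun (iterpd vs f)"
  unfolding test_fun_iff using smooth_iterpd iterpd_eq_0_norm by metis

lemma test_dirderiv: "test_fun f \<Longrightarrow> v \<in> Basis \<Longrightarrow> test_fun (dirderiv v f)"
  using test_iterpd[of f "[v]"] by simp

lemma test_add:
  assumes "test_fun f" "test_fun g"
  shows "test_fun (\<lambda>x. f x + g x)"
proof -
  obtain R R' where "\<forall>x. norm x > R \<longrightarrow> f x = 0" "\<forall>x. norm x > R' \<longrightarrow> g x = 0"
    using assms unfolding test_fun_iff by blast
  then have "\<forall>x. norm x > max R R' \<longrightarrow> f x + g x = 0" by auto
  then show ?thesis using assms smooth_add unfolding test_fun_iff by blast
qed

lemma test_cmult: "test_fun f \<Longrightarrow> test_fun (\<lambda>x. c * f x)"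
  unfolding test_fun_iff using smooth_cmult by fastforce

lemma test_diff: "test_fun f \<Longrightarrow> test_fun g \<Longrightarrow> test_fun (\<lambda>x. f x - g x)"
  using test_add[of f "\<lambda>x. -1 * g x"] test_cmult[of g "-1"] by simp

lemma iterpd_diff:
  assumes "smooth_fun f" "smooth_fun g" "set vs \<subseteq> Basis"
  shows "iterpd vs (\<lambda>x. f x - g x) = (\<lambda>x. iterpd vs f x - iterpd vs g x)"
  using iterpd_add[OF assms(1) smooth_cmult[OF assms(2)] assms(3), of "-1"] iterpd_cmult[OF assms(2,3), of "-1"]
  by simp

lemma test_translate:
  assumes "test_fun f" shows "test_fun (\<lambda>x. f (x + z))"
proof -
  obtain R where R: "\<forall>x. norm x > R \<longrightarrow> f x = 0"
    using assms unfolding test_fun_iff by blast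
  have "f (x + z) = 0" if "norm x > R + norm z" for x
    using R that norm_triangle_ineq4[of "x + z" z] by auto
  then show ?thesis using assms smooth_translate unfolding test_fun_iff by blast
qed

text \<open>Integrate one mixed derivative over a rectangle in both orders and differentiate the result.\<close>

lemma dirderiv_commute:
  assumes f: "smooth_fun f" and u: "u \<in> Basis" and v: "v \<in> Basis"
  shows "dirderiv u (dirderiv v f) = dirderiv v (dirderiv u f)"
proof
  fix x
  define F where "F = (\<lambda>s t. dirderiv v (dirderiv u f) (x + s *\<^sub>R u + t *\<^sub>R v))"
  have su: "smooth_fun (dirderiv u f)" and suv: "smooth_fun (dirderiv v (dirderiv u f))"
    and sv: "smooth_fun (dirderiv v f)"
    using smooth_dirderiv f u v by auto
  have cF: "continuous_on UNIV (\<lambda>(s, t). F s t)"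
    unfolding F_def split_beta by (intro smooth_continuous_compose[OF suv] continuous_intros)
  have cu: "continuous_on S (\<lambda>s. dirderiv u f (x + s *\<^sub>R u))" for S
    by (intro smooth_continuous_compose[OF su] continuous_intros)
  have inner: "integral {0..t} (F s) = dirderiv u f (x + s *\<^sub>R u + t *\<^sub>R v) - dirderiv u f (x + s *\<^sub>R u)"
    if "t \<ge> 0" for s t
  proof (rule integral_unique)
    have "(F s has_integral dirderiv u f (x + s *\<^sub>R u + t *\<^sub>R v) - dirderiv u f (x + s *\<^sub>R u + 0 *\<^sub>R v)) {0..t}"
      unfolding F_def using that
      by (intro fundamental_theorem_of_calculus has_dirderiv_at smooth_has_dirderiv su v)
    then show "(F s has_integral dirderiv u f (x + s *\<^sub>R u + t *\<^sub>R v) - dirderiv u f (x + s *\<^sub>R u)) {0..t}"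
      by simp
  qed
  have outer: "integral {0..s} (\<lambda>r. dirderiv u f (x + r *\<^sub>R u + w)) = f (x + s *\<^sub>R u + w) - f (x + w)"
    if "s \<ge> 0" for s w
  proof (rule integral_unique)
    have "((\<lambda>r. dirderiv u f ((x + w) + r *\<^sub>R u)) has_integral f ((x + w) + s *\<^sub>R u) - f ((x + w) + 0 *\<^sub>R u)) {0..s}"
      using that by (intro fundamental_theorem_of_calculus has_dirderiv_at smooth_has_dirderiv f u)
    then show "((\<lambda>r. dirderiv u f (x + r *\<^sub>R u + w)) has_integral f (x + s *\<^sub>R u + w) - f (x + w)) {0..s}"
      by (simp add: algebra_simps)
  qed
  \<comment> \<open>The double integral is the second difference of \<open>f\<close> over a
    rectangle, an expression symmetric in the two directions.\<close>
  have *: "integral {0..s} (\<lambda>r. integral {0..t} (F r)) = f (x + s *\<^sub>R u + t *\<^sub>R v) - f (x + t *\<^sub>R v) - f (x + s *\<^sub>R u) + f x"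
    if "s \<ge> 0" "t \<ge> 0" for s t
  proof -
    have "integral {0..s} (\<lambda>r. integral {0..t} (F r)) =
       integral {0..s} (\<lambda>r. dirderiv u f (x + r *\<^sub>R u + t *\<^sub>R v) - dirderiv u f (x + r *\<^sub>R u))"
      using inner that by simp
    also have "\<dots> = integral {0..s} (\<lambda>r. dirderiv u f (x + r *\<^sub>R u + t *\<^sub>R v)) - integral {0..s} (\<lambda>r. dirderiv u f (x + r *\<^sub>R u + 0))"
      by (subst integral_diff)
        (auto intro!: integrable_continuous_real cu smooth_continuous_compose[OF su] continuous_intros)
    finally show ?thesis using outer[OF that(1), of "t *\<^sub>R v"] outer[OF that(1), of 0] by simp
  qed
  have swap: "integral {0..s} (\<lambda>r. integral {0..t} (F r)) = integral {0..t} (\<lambda>q. integral {0..s} (\<lambda>r. F r q))" for s t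
    using integral_swap_continuous[of 0 0 s t F] continuous_on_subset[OF cF]
    by (simp add: cbox_interval)
  have cI: "continuous_on {0..1} (\<lambda>q. integral {0..s} (\<lambda>r. F r q))" if "s \<ge> 0" for s
  proof -
    have "continuous_on {0..1} (\<lambda>q. integral (cbox 0 s) (\<lambda>r. F r q))"
      by (rule integral_continuous_on_param) 
        (auto simp: split_beta intro!: continuous_intros continuous_on_compose2[OF cF[unfolded split_beta], of _ "\<lambda>z. (snd z, fst z)", simplified])
    then show ?thesis by (simp add: cbox_interval)
  qed
  \<comment> \<open>Both expressions for the double integral are differentiated in \<open>t\<close>
    at 0. The derivatives are one-sided, within \<open>{0..1}\<close>, since the formulas hold for
    nonnegative side lengths.\<close>
  have D: "dirderiv v f (x + s *\<^sub>R u) - dirderiv v f x = integral {0..s} (\<lambda>r. F r 0)" if "s \<ge> 0" for s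
  proof -
    have I1: "((\<lambda>t. integral {0..t} (\<lambda>q. integral {0..s} (\<lambda>r. F r q))) has_vector_derivative integral {0..s} (\<lambda>r. F r 0)) (at 0 within {0..1})"
      by (rule integral_has_vector_derivative) (use cI that in auto)
    have I2: "integral {0..t} (\<lambda>q. integral {0..s} (\<lambda>r. F r q)) = f (x + s *\<^sub>R u + t *\<^sub>R v) - f (x + t *\<^sub>R v) - f (x + s *\<^sub>R u) + f x" if "t \<in> {0..1}" for t
      using swap[of s t] *[of s t] that \<open>s \<ge> 0\<close> by simp
    from I1 have "((\<lambda>t. f (x + s *\<^sub>R u + t *\<^sub>R v) - f (x + t *\<^sub>R v) - f (x + s *\<^sub>R u) + f x) has_vector_derivative integral {0..s} (\<lambda>r. F r 0)) (at 0 within {0..1})"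
      by (rule has_vector_derivative_transform[rotated 2]) (use I2 in auto)
    moreover have "((\<lambda>t. f (x + s *\<^sub>R u + t *\<^sub>R v) - f (x + t *\<^sub>R v) - f (x + s *\<^sub>R u) + f x) has_vector_derivative dirderiv v f (x + s *\<^sub>R u + 0 *\<^sub>R v) - dirderiv v f (x + 0 *\<^sub>R v) - 0 + 0) (at 0 within {0..1})"
      by (intro has_vector_derivative_add has_vector_derivative_diff has_vector_derivative_const has_dirderiv_at smooth_has_dirderiv f v)
    ultimately show ?thesis
      using vector_derivative_unique_within[of 0 "{0..1::real}"] by (fastforce simp: trivial_limit_within)
  qed
  have "continuous_on {0..1} (\<lambda>r. F r 0)"
    by (rule continuous_on_compose2[OF cF[unfolded split_beta], of _ "\<lambda>r. (r, 0)", simplified]) (auto intro!: continuous_intros)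
  then have "((\<lambda>s. integral {0..s} (\<lambda>r. F r 0)) has_vector_derivative F 0 0) (at 0 within {0..1})"
    by (rule integral_has_vector_derivative) auto
  then have "((\<lambda>s. dirderiv v f (x + s *\<^sub>R u) - dirderiv v f x) has_vector_derivative F 0 0) (at 0 within {0..1})"
    by (rule has_vector_derivative_transform[rotated 2]) (use D in auto)
  moreover have "((\<lambda>s. dirderiv v f (x + s *\<^sub>R u) - dirderiv v f x) has_vector_derivative dirderiv u (dirderiv v f) (x + 0 *\<^sub>R u) - 0) (at 0 within {0..1})"
    by (intro has_vector_derivative_diff has_vector_derivative_const has_dirderiv_at smooth_has_dirderiv sv u)
  ultimately have "F 0 0 = dirderiv u (dirderiv v f) x"
    using vector_derivative_unique_within[of 0 "{0..1::real}"] by (fastforce simp: trivial_limit_within)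
  then show "dirderiv u (dirderiv v f) x = dirderiv v (dirderiv u f) x" by (simp add: F_def)
qed

lemma iterpd_rotate:
  assumes "smooth_fun f" "v \<in> Basis" "set vs \<subseteq> Basis"
  shows "dirderiv v (iterpd vs f) = iterpd vs (dirderiv v f)"
  using assms(3)
proof (induction vs)
  case (Cons w vs)
  then have "dirderiv v (iterpd (w # vs) f) = dirderiv w (dirderiv v (iterpd vs f))"
    using assms dirderiv_commute[of "iterpd vs f" v w] smooth_iterpd[of f vs] by simp
  then show ?case using Cons by simp
qed simp

lemma iterpd_swap:
  assumes "smooth_fun f" "set xs \<subseteq> Basis" "set ys \<subseteq> Basis"
  shows "iterpd xs (iterpd ys f) = iterpd ys (iterpd xs f)"
  using assms(2)
proof (induction xs)
  case (Cons v xs)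
  then have "smooth_fun (iterpd xs f)" using smooth_iterpd assms(1) by auto
  with Cons assms(3) iterpd_rotate[of "iterpd xs f" v ys] show ?case by simp
qed simp

section \<open>Distributions and integrals of smooth families\<close>

lemma compact_support_uniformly_continuous:
  fixes h :: "'a::euclidean_space \<Rightarrow> complex"
  assumes "continuous_on UNIV h" and h0: "\<And>x. norm x > R \<Longrightarrow> h x = 0"
  shows "uniformly_continuous_on UNIV h"
  unfolding uniformly_continuous_on_def
proof (intro allI impI)
  fix e :: real assume e: "e > 0"
  have "uniformly_continuous_on (cball 0 (R + 1)) h"
    by (intro compact_uniformly_continuous continuous_on_subset[OF assms(1)]) auto
  then obtain d where d: "d > 0"
    "\<And>x x'. x \<in> cball 0 (R + 1) \<Longrightarrow> x' \<in> cball 0 (R + 1) \<Longrightarrow> dist x' x < d \<Longrightarrow> dist (h x') (h x) < e"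
    unfolding uniformly_continuous_on_def using e by metis
  \<comment> \<open>If one point lies in the ball of radius \<open>R\<close>, the bound 1 on the
    distance puts both into the compact ball of radius \<open>R + 1\<close>; otherwise both values
    are 0.\<close>
  have "dist (h x') (h x) < e" if "dist x' x < min d 1" for x x'
  proof (cases "norm x \<le> R \<or> norm x' \<le> R")
    case True
    moreover have "norm x' \<le> norm x + dist x' x" "norm x \<le> norm x' + dist x' x"
      by norm+
    ultimately show ?thesis using that d(2)[of x x'] by auto
  next
    case False then show ?thesis using h0 e by auto
  qed
  then show "\<exists>d>0. \<forall>x\<in>UNIV. \<forall>x'\<in>UNIV. dist x' x < d \<longrightarrow> dist (h x') (h x) < e"
    using d(1) by (intro exI[of _ "min d 1"]) auto
qed

lemma D_conv0I:
  assumes "\<And>k. test_fun (\<phi> k)" and "\<And>k x. norm x > R \<Longrightarrow> \<phi> k x = 0"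
    and "\<And>vs e. set vs \<subseteq> Basis \<Longrightarrow> e > 0 \<Longrightarrow> \<forall>\<^sub>F k in sequentially. \<forall>x. norm (iterpd vs (\<phi> k) x) \<le> e"
  shows "D_conv0 \<phi>"
  unfolding D_conv0_def
proof (intro conjI allI impI)
  show "\<exists>K. compact K \<and> (\<forall>k x. x \<notin> K \<longrightarrow> \<phi> k x = 0)"
    using assms(2) by (intro exI[of _ "cball 0 R"]) auto
  show "uniform_limit UNIV (\<lambda>k. iterpd vs (\<phi> k)) (\<lambda>_. 0) sequentially" if "set vs \<subseteq> Basis" for vs
  proof (rule uniform_limitI)
    fix e :: real assume "e > 0"
    then show "\<forall>\<^sub>F n in sequentially. \<forall>x\<in>UNIV. dist (iterpd vs (\<phi> n) x) 0 < e"
      using assms(3)[OF that, of "e/2"] by (auto elim!: eventually_mono) (smt (verit) field_sum_of_halves)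
  qed
qed (use assms(1) in auto)

lemma distribution_add:
  "distribution u \<Longrightarrow> test_fun f \<Longrightarrow> test_fun g \<Longrightarrow> u (\<lambda>x. f x + g x) = u f + u g"
  by (simp add: distribution_def)

lemma distribution_cmult: "distribution u \<Longrightarrow> test_fun f \<Longrightarrow> u (\<lambda>x. c * f x) = c * u f"
  by (simp add: distribution_def)

lemma distribution_diff:
  "distribution u \<Longrightarrow> test_fun f \<Longrightarrow> test_fun g \<Longrightarrow> u (\<lambda>x. f x - g x) = u f - u g"
  using distribution_add[of u f "\<lambda>x. -1 * g x"] distribution_cmult[of u g "-1"] test_cmult[of g "-1"] by simp

lemma distribution_conv0: "distribution u \<Longrightarrow> D_conv0 \<phi> \<Longrightarrow> (\<lambda>k. u (\<phi> k)) \<longlonglongrightarrow> 0"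
  by (simp add: distribution_def)

lemma norm_inverse_mult_le:
  assumes "c \<noteq> 0" "norm X \<le> e * \<bar>c\<bar>"
  shows "norm (inverse (complex_of_real c) * X) \<le> e"
  using assms by (simp add: norm_mult norm_inverse norm_divide divide_simps)

text \<open>The parameter enters through joint continuity of every derivative, which is what the
  Leibniz rule under the integral sign asks for.\<close>

definition smooth_family :: "(real \<Rightarrow> 'a::euclidean_space \<Rightarrow> complex) \<Rightarrow> bool" where
  "smooth_family K \<longleftrightarrow> (\<forall>r. smooth_fun (K r)) \<and>
    (\<forall>vs. set vs \<subseteq> Basis \<longrightarrow> continuous_on UNIV (\<lambda>p. iterpd vs (K (fst p)) (snd p)))"

lemma smooth_family_continuous:
  assumes "smooth_family K" "set vs \<subseteq> Basis" "continuous_on S f" "continuous_on S g"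
  shows "continuous_on S (\<lambda>x. iterpd vs (K (f x)) (g x))"
proof -
  have "continuous_on UNIV (\<lambda>p. iterpd vs (K (fst p)) (snd p))"
    using assms(1,2) by (simp add: smooth_family_def)
  from continuous_on_compose2[OF this, of S "\<lambda>x. (f x, g x)"] assms(3,4) show ?thesis
    by (simp add: continuous_on_Pair)
qed

lemma smooth_family_integrable:
  assumes "smooth_family K" "set vs \<subseteq> Basis"
  shows "(\<lambda>r. iterpd vs (K r) z) integrable_on {a..b}"
  by (intro integrable_continuous_real smooth_family_continuous[OF assms] continuous_intros)

lemma integral_family_has_dirderiv:
  assumes K: "smooth_family K" and vs: "set vs \<subseteq> Basis" and v: "v \<in> Basis"
  shows "has_dirderiv v (\<lambda>z. integral {a..b} (\<lambda>r. iterpd vs (K r) z))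
    (\<lambda>z. integral {a..b} (\<lambda>r. iterpd (v # vs) (K r) z))"
  unfolding has_dirderiv_def
proof
  fix z
  have sm: "smooth_fun (iterpd vs (K r))" for r using K vs smooth_iterpd by (auto simp: smooth_family_def)
  have vs': "set (v # vs) \<subseteq> Basis" using v vs by auto
  have "((\<lambda>s. integral (cbox a b) (\<lambda>r. iterpd vs (K r) (z + s *\<^sub>R v))) has_vector_derivative
      integral (cbox a b) (\<lambda>r. iterpd (v # vs) (K r) (z + 0 *\<^sub>R v))) (at 0 within UNIV)"
  proof (rule leibniz_rule_vector_derivative[where fx="\<lambda>s r. iterpd (v # vs) (K r) (z + s *\<^sub>R v)"])
    show "((\<lambda>s. iterpd vs (K r) (z + s *\<^sub>R v)) has_vector_derivative iterpd (v # vs) (K r) (z + s *\<^sub>R v)) (at s within UNIV)" for s r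
      using has_dirderiv_at[OF smooth_has_dirderiv[OF sm v]] by simp
    show "(\<lambda>r. iterpd vs (K r) (z + s *\<^sub>R v)) integrable_on cbox a b" for s
      using smooth_family_integrable[OF K vs] by (simp add: cbox_interval)
    show "continuous_on (UNIV \<times> cbox a b) (\<lambda>(s, r). iterpd (v # vs) (K r) (z + s *\<^sub>R v))"
      unfolding split_beta by (intro smooth_family_continuous[OF K vs'] continuous_intros)
  qed auto
  then show "((\<lambda>s. integral {a..b} (\<lambda>r. iterpd vs (K r) (z + s *\<^sub>R v))) has_vector_derivative
      integral {a..b} (\<lambda>r. iterpd (v # vs) (K r) z)) (at 0)"
    by (simp add: cbox_interval)
qed

lemma smooth_integral_family:
  assumes K: "smooth_family K"
  shows "smooth_fun (\<lambda>z. integral {a..b} (\<lambda>r. K r z))"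
\<comment> \<open>The invariant class contains the integrals of all derivatives of the family, so
  that one differentiation merely lengthens \<open>vs\<close>.\<close>
proof (rule smooth_coinduct[where P="\<lambda>h. \<exists>vs. set vs \<subseteq> Basis \<and> h = (\<lambda>z. integral {a..b} (\<lambda>r. iterpd vs (K r) z))"])
  show "\<exists>vs. set vs \<subseteq> Basis \<and> (\<lambda>z. integral {a..b} (\<lambda>r. K r z)) = (\<lambda>z. integral {a..b} (\<lambda>r. iterpd vs (K r) z))"
    by (rule exI[of _ "[]"]) simp
  show "continuous_on UNIV h" if h: "\<exists>vs. set vs \<subseteq> Basis \<and> h = (\<lambda>z. integral {a..b} (\<lambda>r. iterpd vs (K r) z))" for h
  proof -
    obtain vs where vs: "set vs \<subseteq> Basis" and h: "h = (\<lambda>z. integral {a..b} (\<lambda>r. iterpd vs (K r) z))"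
      using h by blast
    have "continuous_on UNIV (\<lambda>z. integral (cbox a b) (\<lambda>r. iterpd vs (K r) z))"
      by (rule integral_continuous_on_param)
        (unfold split_beta, intro smooth_family_continuous[OF K vs] continuous_intros)
    then show ?thesis by (simp add: h cbox_interval)
  qed
  show "\<exists>h'. has_dirderiv v h h' \<and> (\<exists>vs. set vs \<subseteq> Basis \<and> h' = (\<lambda>z. integral {a..b} (\<lambda>r. iterpd vs (K r) z)))"
    if h: "\<exists>vs. set vs \<subseteq> Basis \<and> h = (\<lambda>z. integral {a..b} (\<lambda>r. iterpd vs (K r) z))" and v: "v \<in> Basis" for h v
  proof -
    obtain vs where vs: "set vs \<subseteq> Basis" and h: "h = (\<lambda>z. integral {a..b} (\<lambda>r. iterpd vs (K r) z))"
      using h by blast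
    have "set (v # vs) \<subseteq> Basis" using v vs by simp
    then show ?thesis using integral_family_has_dirderiv[OF K vs v] h by blast
  qed
qed

lemma iterpd_integral_family:
  assumes K: "smooth_family K" and "set vs \<subseteq> Basis"
  shows "iterpd vs (\<lambda>z. integral {a..b} (\<lambda>r. K r z)) = (\<lambda>z. integral {a..b} (\<lambda>r. iterpd vs (K r) z))"
  using assms(2)
proof (induction vs)
  case (Cons v vs)
  then show ?case
    using dirderiv_eq[OF integral_family_has_dirderiv[OF K, of vs v]] by simp
qed simp

text \<open>A distribution annihilating every member of a family annihilates its integral: by bisection it
  suffices to see this to first order near each parameter value, where the averages converge to a member.\<close>

lemma distribution_integral_eq_0:
  fixes K :: "real \<Rightarrow> 'a::euclidean_space \<Rightarrow> complex"
  assumes u: "distribution u" and K: "smooth_family K"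
    and supp: "\<And>r z. norm (r, z) > R \<Longrightarrow> K r z = 0"
    and u0: "\<And>r. u (K r) = 0" and "a \<le> b"
  shows "u (\<lambda>z. integral {a..b} (\<lambda>r. K r z)) = 0"
proof -
  define H where "H a b = (\<lambda>z. integral {a..b} (\<lambda>r. K r z))" for a b
  have supp': "K r z = 0" if "norm z > R" for r z
    using supp[of r z] that norm_ge_zero[of r] by (smt (verit, best) norm_snd_le snd_conv)
  have testK: "test_fun (K r)" for r
    using K supp' unfolding test_fun_iff smooth_family_def by blast
  have H0: "H a b z = 0" if "norm z > R" for a b z
    unfolding H_def using supp'[OF that] by simp
  have testH: "test_fun (H a b)" for a b
    unfolding test_fun_iff using smooth_integral_family[OF K] H0 unfolding H_def by blast
  have int: "(\<lambda>r. K r z) integrable_on {a..b}" for z a b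
    using smooth_family_integrable[OF K, of "[]"] by simp
  \<comment> \<open>On short intervals around \<open>x\<close> the value is at most a small multiple
    of the length. As \<open>u\<close> is sequentially continuous, a failure is turned into
    intervals from \<open>A n\<close> to \<open>B n\<close> shrinking to \<open>x\<close>.\<close>
  have near: "\<exists>d>0. \<forall>a b. a \<le> x \<and> x \<le> b \<and> b - a < d \<longrightarrow> norm (u (H a b)) \<le> e * (b - a)" if e: "e > 0" for e x
  proof (rule ccontr)
    assume neg: "\<not> (\<exists>d>0. \<forall>a b. a \<le> x \<and> x \<le> b \<and> b - a < d \<longrightarrow> norm (u (H a b)) \<le> e * (b - a))"
    have "\<exists>a b. a \<le> x \<and> x \<le> b \<and> b - a < inverse (real (Suc n)) \<and> norm (u (H a b)) > e * (b - a)" for n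
    proof -
      have "inverse (real (Suc n)) > 0" by simp
      then show ?thesis using neg by (metis not_le)
    qed
    then obtain A B where AB: "\<And>n. A n \<le> x" "\<And>n. x \<le> B n" "\<And>n. B n - A n < inverse (real (Suc n))"
      "\<And>n. norm (u (H (A n) (B n))) > e * (B n - A n)"
      by metis
    have lt: "A n < B n" for n
    proof (rule ccontr)
      assume "\<not> A n < B n"
      then have "A n = B n" using AB(1,2)[of n] by linarith
      then have "H (A n) (B n) = (\<lambda>z. 0)" by (simp add: H_def)
      moreover have "u (\<lambda>z. 0) = 0" using distribution_cmult[OF u testH[of 0 0], of 0] by simp
      ultimately have "u (H (A n) (B n)) = 0" by simp
      then show False using AB(4)[of n] \<open>A n = B n\<close> by simp
    qed
    \<comment> \<open>Mean of the family over the \<open>n\<close>-th interval minus the member at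
      \<open>x\<close>. Since \<open>u\<close> kills \<open>K x\<close>, \<open>u (\<phi> n)\<close>
      is the quotient that was assumed to stay larger than \<open>e\<close>.\<close>
    define \<phi> where "\<phi> n = (\<lambda>z. complex_of_real (inverse (B n - A n)) * H (A n) (B n) z - K x z)" for n
    have "D_conv0 \<phi>"
    proof (rule D_conv0I[of _ R])
      show "test_fun (\<phi> n)" for n unfolding \<phi>_def by (intro test_diff test_cmult testH testK)
      show "\<phi> n z = 0" if "norm z > R" for n z using that H0 supp' by (simp add: \<phi>_def)
      fix vs :: "'a list" and e' :: real assume vs: "set vs \<subseteq> Basis" and e': "e' > 0"
      define h where "h = (\<lambda>p. iterpd vs (K (fst p)) (snd p))"
      have ch: "continuous_on UNIV h" using K vs by (simp add: h_def smooth_family_def)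
      \<comment> \<open>Compact support jointly in parameter and point gives uniform continuity, so
        the means over short intervals converge uniformly in \<open>z\<close>.\<close>
      have "h p = 0" if "norm p > R + 1" for p
      proof (cases "norm (snd p) > R")
        case True then show ?thesis unfolding h_def using iterpd_eq_0_norm supp' by blast
      next
        case False
        have "open {z. norm (fst p, z) > R}" by (intro open_Collect_less continuous_intros)
        then show ?thesis unfolding h_def
          by (rule iterpd_eq_0) (use supp that in auto)
      qed
      then have "uniformly_continuous_on UNIV h"
        by (rule compact_support_uniformly_continuous[OF ch])
      then obtain d where d: "d > 0" "\<And>p q. dist q p < d \<Longrightarrow> dist (h q) (h p) < e'"
        unfolding uniformly_continuous_on_def using e' by (metis UNIV_I)
      have bound: "norm (iterpd vs (\<phi> n) z) \<le> e'" if "inverse (real (Suc n)) < d" for n z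
      proof -
        have len: "B n - A n > 0" using lt[of n] by simp
        have i: "iterpd vs (\<phi> n) z = complex_of_real (inverse (B n - A n)) * integral {A n..B n} (\<lambda>r. h (r, z)) - h (x, z)"
          unfolding \<phi>_def
          by (subst iterpd_diff) (use vs testH testK K in \<open>simp_all add: iterpd_cmult test_smooth test_cmult H_def iterpd_integral_family h_def\<close>)
        have hi: "(\<lambda>r. h (r, z)) integrable_on {A n..B n}"
          using smooth_family_integrable[OF K vs] by (simp add: h_def)
        have "integral {A n..B n} (\<lambda>r. h (r, z) - h (x, z)) = integral {A n..B n} (\<lambda>r. h (r, z)) - complex_of_real (B n - A n) * h (x, z)"
          using hi len by (subst integral_diff) (auto simp: scaleR_conv_of_real)
        then have "iterpd vs (\<phi> n) z = complex_of_real (inverse (B n - A n)) * integral {A n..B n} (\<lambda>r. h (r, z) - h (x, z))"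
          unfolding i using len by (simp add: field_simps)
        moreover have "norm (integral {A n..B n} (\<lambda>r. h (r, z) - h (x, z))) \<le> e' * (B n - A n)"
        proof (rule integral_bound)
          show "continuous_on {A n..B n} (\<lambda>r. h (r, z) - h (x, z))"
            by (intro continuous_intros continuous_on_compose2[OF ch]) auto
          fix r assume "r \<in> {A n..B n}"
          then have "dist (r, z) (x, z) < d" using AB(1,2,3)[of n] that by (auto simp: dist_Pair_Pair dist_real_def)
          then show "norm (h (r, z) - h (x, z)) \<le> e'" using d(2) by (simp add: dist_norm less_imp_le)
        qed (use len in auto)
        ultimately show ?thesis using len norm_inverse_mult_le[of "B n - A n"] by simp
      qed
      have "\<forall>\<^sub>F n in sequentially. inverse (real (Suc n)) < d"
        using LIMSEQ_inverse_real_of_nat d(1) by (rule order_tendstoD)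
      then show "\<forall>\<^sub>F n in sequentially. \<forall>z. norm (iterpd vs (\<phi> n) z) \<le> e'"
        by (rule eventually_mono) (use bound in blast)
    qed
    then have "(\<lambda>n. u (\<phi> n)) \<longlonglongrightarrow> 0" by (rule distribution_conv0[OF u])
    then have "\<forall>\<^sub>F n in sequentially. norm (u (\<phi> n)) < e"
      using e by (metis tendsto_norm_zero order_tendstoD(2))
    then obtain n where "norm (u (\<phi> n)) < e" using eventually_happens'[OF sequentially_bot] by blast
    moreover have "u (\<phi> n) = complex_of_real (inverse (B n - A n)) * u (H (A n) (B n))"
      unfolding \<phi>_def using distribution_diff[OF u test_cmult[OF testH] testK] distribution_cmult[OF u testH] u0 by simp
    ultimately have "inverse (B n - A n) * norm (u (H (A n) (B n))) < e"
      using lt[of n] by (simp only: norm_mult norm_of_real) simp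
    then show False using AB(4)[of n] lt[of n] by (simp add: field_simps)
  qed
  \<comment> \<open>\<open>Bolzano\<close> passes from short intervals to \<open>{a..b}\<close>: the
    bound is additive over adjacent intervals, and \<open>near\<close> provides it locally.\<close>
  have "norm (u (H a b)) \<le> e * (b - a)" if e: "e > 0" for e
    using \<open>a \<le> b\<close>
  proof (induction rule: Bolzano)
    case (trans a b c)
    have "H a c = (\<lambda>z. H a b z + H b c z)"
      unfolding H_def using trans int by (auto simp: Henstock_Kurzweil_Integration.integral_combine)
    then have "u (H a c) = u (H a b) + u (H b c)" using distribution_add[OF u testH testH] by simp
    then show ?case using trans norm_triangle_ineq[of "u (H a b)" "u (H b c)"] by (simp add: algebra_simps)
  next
    case (local x) show ?case by (rule near[OF e])
  qed
  note bound = this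
  have "norm (u (H a b)) \<le> 0 + e" if "e > 0" for e
  proof (cases "a = b")
    case True then show ?thesis using bound[of 1] that by simp
  next
    case False then show ?thesis using bound[of "e / (b - a)"] that \<open>a \<le> b\<close> by simp
  qed
  then have "norm (u (H a b)) \<le> 0" by (rule field_le_epsilon)
  then show ?thesis by (simp add: H_def)
qed

text \<open>This is the convolution of \<open>u\<close> with the reflection of \<open>f\<close>,
  evaluated at \<open>-z\<close>. With this convention derivatives pass to \<open>f\<close> without
  a change of sign.\<close>

definition regularize :: "(('a::euclidean_space \<Rightarrow> complex) \<Rightarrow> complex) \<Rightarrow> ('a \<Rightarrow> complex) \<Rightarrow> 'a \<Rightarrow> complex" where
  "regularize u f z = u (\<lambda>w. f (w + z))"

text \<open>Translates of a test function depend continuously on the translation in the sense of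
  \<open>D_conv0\<close>, because each of its derivatives is uniformly continuous.\<close>

lemma regularize_continuous:
  assumes u: "distribution u" and f: "test_fun f"
  shows "continuous_on UNIV (regularize u f)"
proof -
  obtain R where R: "\<And>x. norm x > R \<Longrightarrow> f x = 0" using f unfolding test_fun_iff by blast
  have "isCont (regularize u f) z" for z
    unfolding continuous_at_sequentially
  proof (intro allI impI)
    fix x :: "nat \<Rightarrow> 'a" assume x: "x \<longlonglongrightarrow> z"
    define \<phi> where "\<phi> n = (\<lambda>w. f (w + x n) - f (w + z))" for n
    obtain C where C: "\<And>n. norm (x n) \<le> C"
      using convergent_imp_Bseq[of x] x unfolding convergent_def Bseq_def by blast
    have "norm z \<le> C" using LIMSEQ_le_const2[OF tendsto_norm[OF x]] C by blast
    have "D_conv0 \<phi>"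
    proof (rule D_conv0I[of _ "R + C"])
      show "test_fun (\<phi> n)" for n unfolding \<phi>_def by (intro test_diff test_translate f)
      show "\<phi> n w = 0" if "norm w > R + C" for n w
        using R[of "w + x n"] R[of "w + z"] C[of n] \<open>norm z \<le> C\<close> that norm_triangle_ineq4[of "w + x n" "x n"]
          norm_triangle_ineq4[of "w + z" z] by (simp add: \<phi>_def)
      fix vs :: "'a list" and e :: real assume vs: "set vs \<subseteq> Basis" and e: "e > 0"
      have "uniformly_continuous_on UNIV (iterpd vs f)"
        using compact_support_uniformly_continuous[of "iterpd vs f" R] iterpd_eq_0_norm[of R f] R
          smooth_continuous[OF smooth_iterpd[OF test_smooth[OF f] vs]] by blast
      then obtain d where d: "d > 0" "\<And>p q. dist q p < d \<Longrightarrow> dist (iterpd vs f q) (iterpd vs f p) < e"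
        unfolding uniformly_continuous_on_def using e by (metis UNIV_I)
      have it: "iterpd vs (\<phi> n) w = iterpd vs f (w + x n) - iterpd vs f (w + z)" for n w
        unfolding \<phi>_def using vs test_smooth[OF f] by (simp add: iterpd_diff iterpd_translate smooth_translate)
      have "\<forall>\<^sub>F n in sequentially. dist (x n) z < d" using x d(1) by (rule tendstoD)
      then show "\<forall>\<^sub>F n in sequentially. \<forall>w. norm (iterpd vs (\<phi> n) w) \<le> e"
      proof (rule eventually_mono, intro allI)
        fix n w assume "dist (x n) z < d"
        then have "dist (w + x n) (w + z) < d" by simp
        then show "norm (iterpd vs (\<phi> n) w) \<le> e" unfolding it using d(2) by (metis dist_norm less_imp_le)
      qed
    qed
    then have "(\<lambda>n. u (\<phi> n)) \<longlonglongrightarrow> 0" by (rule distribution_conv0[OF u])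
    then have "(\<lambda>n. regularize u f (x n) - regularize u f z) \<longlonglongrightarrow> 0"
      unfolding \<phi>_def regularize_def using distribution_diff[OF u test_translate[OF f] test_translate[OF f]] by simp
    then show "(regularize u f \<circ> x) \<longlonglongrightarrow> regularize u f z"
      using LIM_zero_iff by (force simp: o_def)
  qed
  then show ?thesis by (simp add: continuous_at_imp_continuous_on)
qed

text \<open>The difference quotients of \<open>f\<close> converge to \<open>dirderiv v f\<close> in
  the sense of \<open>D_conv0\<close>, and \<open>u\<close> preserves this limit.\<close>

lemma regularize_has_dirderiv:
  assumes u: "distribution u" and f: "test_fun f" and v: "v \<in> Basis"
  shows "has_dirderiv v (regularize u f) (regularize u (dirderiv v f))"
  unfolding has_dirderiv_def
proof
  fix z
  obtain R where R: "\<And>x. norm x > R \<Longrightarrow> f x = 0" using f unfolding test_fun_iff by blast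
  let ?g = "\<lambda>s. regularize u f (z + s *\<^sub>R v)" and ?D = "regularize u (dirderiv v f) z"
  have "(\<lambda>s. (?g s - ?g 0) / complex_of_real s - ?D) \<midarrow>0\<rightarrow> 0"
    unfolding LIMSEQ_SEQ_conv[symmetric]
  proof (intro allI impI)
    fix s :: "nat \<Rightarrow> real" assume "(\<forall>n. s n \<noteq> 0) \<and> s \<longlonglongrightarrow> 0"
    then have s0: "\<And>n. s n \<noteq> 0" and s: "s \<longlonglongrightarrow> 0" by auto
    define \<phi> where "\<phi> n = (\<lambda>w. inverse (complex_of_real (s n)) * (f (w + (z + s n *\<^sub>R v)) - f (w + z)) - dirderiv v f (w + z))" for n
    obtain C where C: "\<And>n. norm (s n) \<le> C"
      using convergent_imp_Bseq[of s] s unfolding convergent_def Bseq_def by blast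
    have C0: "C \<ge> 0" using C[of 0] norm_ge_zero order_trans by blast
    have dv: "dirderiv v f x = 0" if "norm x > R" for x
      using iterpd_eq_0_norm[of R f x "[v]"] R that by simp
    have test: "test_fun (\<lambda>w. inverse (complex_of_real (s n)) * (f (w + (z + s n *\<^sub>R v)) - f (w + z)))"
      "test_fun (\<lambda>w. f (w + (z + s n *\<^sub>R v)))" "test_fun (\<lambda>w. f (w + z))" "test_fun (\<lambda>w. dirderiv v f (w + z))"
      "test_fun (\<lambda>w. f (w + (z + s n *\<^sub>R v)) - f (w + z))" for n
      by (intro test_diff test_cmult test_translate f test_dirderiv v)+
    have "D_conv0 \<phi>"
    proof (rule D_conv0I[of _ "R + norm z + C"])
      show "test_fun (\<phi> n)" for n unfolding \<phi>_def by (intro test_diff test)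
      show "\<phi> n w = 0" if "norm w > R + norm z + C" for n w
      proof -
        have "norm (w + z) > R" using that C0 norm_triangle_ineq4[of "w + z" z] by simp
        moreover have "norm (w + (z + s n *\<^sub>R v)) > R"
        proof -
          have "norm (z + s n *\<^sub>R v) \<le> norm z + C"
            using norm_triangle_ineq[of z "s n *\<^sub>R v"] C[of n] v by simp
          then show ?thesis using that norm_triangle_ineq4[of "w + (z + s n *\<^sub>R v)" "z + s n *\<^sub>R v"] by simp
        qed
        ultimately show ?thesis using R dv by (simp add: \<phi>_def)
      qed
      fix vs :: "'a list" and e :: real assume vs: "set vs \<subseteq> Basis" and e: "e > 0"
      define h where "h = iterpd vs f"
      have sh: "smooth_fun h" unfolding h_def by (intro smooth_iterpd vs test_smooth f)
      \<comment> \<open>Here mixed derivatives must commute: the derivative \<open>iterpd vs\<close>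
        of the expected limit is the \<open>v\<close>-derivative of \<open>h\<close>, and can be
        compared with difference quotients of \<open>h\<close>.\<close>
      have hv: "dirderiv v h = iterpd vs (dirderiv v f)"
        unfolding h_def by (rule iterpd_rotate[OF test_smooth[OF f] v vs])
      have "dirderiv v h x = 0" if "norm x > R" for x
        unfolding h_def using iterpd_eq_0_norm[of R f x "v # vs"] R that by simp
      then have "uniformly_continuous_on UNIV (dirderiv v h)"
        by (intro compact_support_uniformly_continuous smooth_continuous smooth_dirderiv sh v)
      then obtain d where d: "d > 0" "\<And>p q. dist q p < d \<Longrightarrow> dist (dirderiv v h q) (dirderiv v h p) < e"
        unfolding uniformly_continuous_on_def using e by (metis UNIV_I)
      have it: "iterpd vs (\<phi> n) w = inverse (complex_of_real (s n)) * (h (w + (z + s n *\<^sub>R v)) - h (w + z)) - dirderiv v h (w + z)" for n w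
        unfolding \<phi>_def hv unfolding h_def
        using vs test_smooth[OF f] test_smooth[OF test(1)[of n]] test_smooth[OF test(2)[of n]]
          test_smooth[OF test(3)] test_smooth[OF test(4)] test_smooth[OF test(5)[of n]] smooth_dirderiv[OF test_smooth[OF f] v]
        by (simp add: iterpd_diff iterpd_cmult iterpd_translate)
      have "norm (iterpd vs (\<phi> n) w) \<le> e" if "dist (s n) 0 < d" for n w
      proof -
        \<comment> \<open>Mean value estimate: the error of the difference quotient is bounded by
          the oscillation of \<open>dirderiv v h\<close> along the segment, uniformly in
          \<open>w\<close>.\<close>
        have "norm (h (w + z + s n *\<^sub>R v) - h (w + z + 0 *\<^sub>R v) - (s n - 0) *\<^sub>R dirderiv v h (w + z + 0 *\<^sub>R v)) \<le> norm (s n - 0) * e"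
        proof (rule vector_differentiable_bound_linearization[where S="closed_segment 0 (s n)" and f="\<lambda>r. h (w + z + r *\<^sub>R v)"
              and f'="\<lambda>r. dirderiv v h (w + z + r *\<^sub>R v)"])
          fix r assume r: "r \<in> closed_segment 0 (s n)"
          show "((\<lambda>r. h (w + z + r *\<^sub>R v)) has_vector_derivative dirderiv v h (w + z + r *\<^sub>R v)) (at r within closed_segment 0 (s n))"
            by (rule has_dirderiv_at[OF smooth_has_dirderiv[OF sh v]])
          have "dist r 0 < d" using dist_in_closed_segment[OF r] that by (smt (verit) dist_commute)
          then have "dist (w + z + r *\<^sub>R v) (w + z + 0 *\<^sub>R v) < d" using v by (simp add: dist_norm)
          then show "norm (dirderiv v h (w + z + r *\<^sub>R v) - dirderiv v h (w + z + 0 *\<^sub>R v)) \<le> e"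
            using d(2) by (metis dist_norm less_imp_le)
        qed auto
        then have *: "norm (h (w + (z + s n *\<^sub>R v)) - h (w + z) - complex_of_real (s n) * dirderiv v h (w + z)) \<le> \<bar>s n\<bar> * e"
          by (simp add: add.assoc scaleR_conv_of_real)
        have "iterpd vs (\<phi> n) w = inverse (complex_of_real (s n)) * (h (w + (z + s n *\<^sub>R v)) - h (w + z) - complex_of_real (s n) * dirderiv v h (w + z))"
          unfolding it using s0[of n] by (simp add: field_simps)
        then show ?thesis using * s0[of n] norm_inverse_mult_le[of "s n"] by (simp add: mult.commute[of e])
      qed
      moreover have "\<forall>\<^sub>F n in sequentially. dist (s n) 0 < d" using s d(1) by (rule tendstoD)
      ultimately show "\<forall>\<^sub>F n in sequentially. \<forall>w. norm (iterpd vs (\<phi> n) w) \<le> e"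
        by (auto elim: eventually_mono)
    qed
    then have "(\<lambda>n. u (\<phi> n)) \<longlonglongrightarrow> 0" by (rule distribution_conv0[OF u])
    moreover have "u (\<phi> n) = (?g (s n) - ?g 0) / complex_of_real (s n) - ?D" for n
      unfolding \<phi>_def distribution_diff[OF u test(1) test(4)] distribution_cmult[OF u test(5)]
        distribution_diff[OF u test(2) test(3)]
      by (simp add: regularize_def field_simps)
    ultimately show "(\<lambda>n. (?g (s n) - ?g 0) / complex_of_real (s n) - ?D) \<longlonglongrightarrow> 0" by simp
  qed
  then have "(\<lambda>s. norm ((?g s - ?g 0) / complex_of_real s - ?D)) \<midarrow>0\<rightarrow> 0"
    by (rule tendsto_norm_zero)
  moreover have "norm ((?g s - ?g 0) / complex_of_real s - ?D) = norm (?g (0 + s) - ?g 0 - s *\<^sub>R ?D) / norm s"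
    if "s \<noteq> 0" for s
  proof -
    have "(?g s - ?g 0) / complex_of_real s - ?D = (?g s - ?g 0 - s *\<^sub>R ?D) / complex_of_real s"
      using that by (simp add: field_simps scaleR_conv_of_real)
    then show ?thesis by (simp add: norm_divide)
  qed
  ultimately have "(\<lambda>s. norm (?g (0 + s) - ?g 0 - s *\<^sub>R ?D) / norm s) \<midarrow>0\<rightarrow> 0"
    by (simp cong: LIM_cong)
  then show "(?g has_vector_derivative ?D) (at 0)"
    unfolding has_vector_derivative_def has_derivative_at by (intro conjI bounded_linear_scaleR_left)
qed

lemma smooth_regularize:
  assumes u: "distribution u" and "test_fun f"
  shows "smooth_fun (regularize u f)"
proof (rule smooth_coinduct[where P="\<lambda>h. \<exists>f. test_fun f \<and> h = regularize u f"])
  show "\<exists>h'. has_dirderiv v h h' \<and> (\<exists>f. test_fun f \<and> h' = regularize u f)"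
    if "\<exists>f. test_fun f \<and> h = regularize u f" "v \<in> Basis" for h v
    using that regularize_has_dirderiv[OF u] test_dirderiv by blast
qed (use assms regularize_continuous in blast)+

lemma iterpd_regularize:
  assumes "distribution u" "test_fun f" "set vs \<subseteq> Basis"
  shows "iterpd vs (regularize u f) = regularize u (iterpd vs f)"
  using assms(3)
proof (induction vs)
  case (Cons v vs)
  then show ?case
    using dirderiv_eq[OF regularize_has_dirderiv[OF assms(1) test_iterpd[OF assms(2)]]] by simp
qed simp

section \<open>Bump functions and density of tensor products\<close>

text \<open>Each derivative brings out a factor \<open>c\<close>, which the free factor
  \<open>k\<close> of the invariant class absorbs. Reflected and rescaled bumps are obtained this
  way.\<close>

lemma smooth_affine_real:
  fixes f :: "real \<Rightarrow> complex"
  assumes "smooth_fun f"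
  shows "smooth_fun (\<lambda>t. f (c * t + d))"
proof (rule smooth_coinduct[where P="\<lambda>h. \<exists>k f. smooth_fun f \<and> h = (\<lambda>t. k * f (c * t + d))"])
  show "\<exists>k g. smooth_fun g \<and> (\<lambda>t. f (c * t + d)) = (\<lambda>t. k * g (c * t + d))"
    using assms by (intro exI[of _ 1] exI[of _ f]) auto
  show "continuous_on UNIV h" if "\<exists>k f. smooth_fun f \<and> h = (\<lambda>t. k * f (c * t + d))" for h :: "real \<Rightarrow> complex"
    using that by (elim exE conjE, hypsubst)
      (intro continuous_on_mult continuous_on_const, erule smooth_continuous_compose, intro continuous_intros)
  fix h :: "real \<Rightarrow> complex" and v :: real
  assume "\<exists>k f. smooth_fun f \<and> h = (\<lambda>t. k * f (c * t + d))" and v: "v \<in> Basis"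
  then obtain k f where f: "smooth_fun f" and h: "h = (\<lambda>t. k * f (c * t + d))" by blast
  have v1: "v = 1" using v by simp
  have "has_dirderiv v (\<lambda>t. f (c * t + d)) (\<lambda>t. c *\<^sub>R dirderiv v f (c * t + d))"
    unfolding has_dirderiv_def
  proof
    fix t
    have "((\<lambda>s. f ((c * t + d) + s *\<^sub>R v)) has_vector_derivative dirderiv v f ((c * t + d) + (c * 0) *\<^sub>R v)) (at (c * 0))"
      by (rule has_dirderiv_at[OF smooth_has_dirderiv[OF f v]])
    then have "((\<lambda>s. f ((c * t + d) + s *\<^sub>R v)) \<circ> (\<lambda>s. c * s) has_vector_derivative c *\<^sub>R dirderiv v f ((c * t + d) + (c * 0) *\<^sub>R v)) (at 0)"
      by (intro vector_diff_chain_at) (auto intro!: derivative_eq_intros)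
    then show "((\<lambda>s. f (c * (t + s *\<^sub>R v) + d)) has_vector_derivative c *\<^sub>R dirderiv v f (c * t + d)) (at 0)"
      by (simp add: o_def v1 algebra_simps)
  qed
  from has_dirderiv_cmult[OF this, of k]
  have "has_dirderiv v h (\<lambda>t. (k * complex_of_real c) * dirderiv v f (c * t + d))"
    unfolding h by (simp add: scaleR_conv_of_real mult.assoc)
  then show "\<exists>h'. has_dirderiv v h h' \<and> (\<exists>k f. smooth_fun f \<and> h' = (\<lambda>t. k * f (c * t + d)))"
    using smooth_dirderiv[OF f v] by blast
qed

lemma tendsto_poly_times_exp_minus: "((\<lambda>x. poly Q x * exp (- x)) \<longlongrightarrow> 0) (at_top :: real filter)"
proof -
  have "((\<lambda>x. \<Sum>i\<le>degree Q. coeff Q i * (x ^ i / exp x)) \<longlongrightarrow> (\<Sum>i\<le>degree Q. coeff Q i * 0)) (at_top :: real filter)"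
    by (intro tendsto_intros tendsto_power_div_exp_0)
  then show ?thesis by (simp add: poly_altdef exp_minus field_simps sum_distrib_left sum_divide_distrib)
qed

text \<open>For \<open>Q = 1\<close> this is the classical smooth function flat at 0; the polynomial
  in \<open>1 / t\<close> makes the family closed under differentiation.\<close>

definition flat :: "real poly \<Rightarrow> real \<Rightarrow> real" where
  "flat Q t = (if t > 0 then poly Q (1 / t) * exp (- (1 / t)) else 0)"

text \<open>With \<open>x = 1 / t\<close>, the derivative of \<open>Q(x) exp(-x)\<close> in
  \<open>t\<close> is \<open>x^2 (Q - Q')(x) exp(-x)\<close>, the two \<open>pCons 0\<close> being
  the factor \<open>x^2\<close>. At 0 the right-hand quotient is \<open>x Q(x) exp(-x)\<close>,
  which tends to 0 as \<open>x\<close> grows.\<close>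

lemma flat_has_derivative:
  "(flat Q has_real_derivative flat (pCons 0 (pCons 0 (Q - pderiv Q))) t) (at t)"
proof (cases "t = 0")
  case False
  show ?thesis
  proof (cases "t > 0")
    case True
    have "((\<lambda>t. poly Q (1 / t) * exp (- (1 / t))) has_real_derivative flat (pCons 0 (pCons 0 (Q - pderiv Q))) t) (at t)"
      using True by (auto simp: flat_def power2_eq_square field_simps intro!: derivative_eq_intros)
    moreover have "\<forall>\<^sub>F s in nhds t. flat Q s = poly Q (1 / s) * exp (- (1 / s))"
      using eventually_nhds_in_open[of "{0<..}" t] True by (auto elim!: eventually_mono simp: flat_def)
    ultimately show ?thesis by (subst DERIV_cong_ev[OF refl _ refl])
  next
    case neg: False
    have "\<forall>\<^sub>F s in nhds t. flat Q s = 0"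
      using eventually_nhds_in_open[of "{..<0}" t] False neg by (auto elim!: eventually_mono simp: flat_def)
    then have "(flat Q has_real_derivative 0) (at t)"
      by (subst DERIV_cong_ev[OF refl _ refl]) auto
    then show ?thesis using neg by (simp add: flat_def)
  qed
next
  case True
  have "((\<lambda>h. flat Q h / h) \<longlongrightarrow> 0) (at_right 0)"
  proof -
    have "((\<lambda>x. poly (pCons 0 Q) x * exp (- x)) \<longlongrightarrow> 0) at_top" by (rule tendsto_poly_times_exp_minus)
    moreover have "\<forall>\<^sub>F x in at_top. poly (pCons 0 Q) x * exp (- x) = flat Q (inverse x) / inverse x"
      using eventually_gt_at_top[of 0] by eventually_elim (auto simp: flat_def field_simps)
    ultimately show ?thesis
      unfolding filterlim_at_right_to_top by (rule Lim_transform_eventually)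
  qed
  moreover have "((\<lambda>h. flat Q h / h) \<longlongrightarrow> 0) (at_left 0)"
  proof (rule Lim_transform_eventually[OF tendsto_const])
    show "\<forall>\<^sub>F h in at_left 0. 0 = flat Q h / h"
      unfolding eventually_at_left_field by (intro exI[of _ "-1"]) (auto simp: flat_def)
  qed
  ultimately have "((\<lambda>h. flat Q h / h) \<longlongrightarrow> 0) (at 0)"
    by (simp add: filterlim_split_at)
  then show ?thesis using True by (simp add: DERIV_def flat_def)
qed

lemma smooth_flat: "smooth_fun (\<lambda>t. complex_of_real (flat Q t))"
proof (rule smooth_coinduct[where P="\<lambda>h. \<exists>Q. h = (\<lambda>t. complex_of_real (flat Q t))"])
  fix h :: "real \<Rightarrow> complex" assume "\<exists>Q. h = (\<lambda>t. complex_of_real (flat Q t))"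
  then obtain Q where h: "h = (\<lambda>t. complex_of_real (flat Q t))" by blast
  have "continuous_on UNIV (flat Q)"
    by (meson DERIV_continuous_on DERIV_subset flat_has_derivative subset_UNIV)
  then show "continuous_on UNIV h" unfolding h by (intro continuous_intros)
  have D: "has_dirderiv 1 h (\<lambda>t. complex_of_real (flat (pCons 0 (pCons 0 (Q - pderiv Q))) t))"
    unfolding has_dirderiv_def
  proof
    fix t
    have "((\<lambda>s. flat Q (t + s)) has_real_derivative flat (pCons 0 (pCons 0 (Q - pderiv Q))) t) (at 0)"
      using DERIV_shift[of "flat Q" _ 0 t] flat_has_derivative[of Q t] by (simp add: add.commute)
    then show "((\<lambda>s. h (t + s *\<^sub>R 1)) has_vector_derivative complex_of_real (flat (pCons 0 (pCons 0 (Q - pderiv Q))) t)) (at 0)"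
      unfolding h by (intro has_vector_derivative_of_real)
        (simp add: has_real_derivative_iff_has_vector_derivative[symmetric])
  qed
  fix v :: real assume "v \<in> Basis"
  then show "\<exists>h'. has_dirderiv v h h' \<and> (\<exists>Q. h' = (\<lambda>t. complex_of_real (flat Q t)))" using D by auto
qed blast

lemma bump_exists:
  "\<exists>b :: real \<Rightarrow> real. smooth_fun (\<lambda>t. complex_of_real (b t)) \<and> continuous_on UNIV b \<and>
    (\<forall>t. b t \<ge> 0) \<and> (\<forall>t. t \<notin> {0..1} \<longrightarrow> b t = 0) \<and> (\<forall>t\<in>{0<..<1}. b t > 0) \<and> integral {0..1} b = 1"
proof -
  \<comment> \<open>One factor dies at 0, its reflection at 1; division by the integral
    \<open>I\<close> normalises the product.\<close>
  define b0 where "b0 t = flat 1 t * flat 1 (1 - t)" for t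
  define I where "I = integral {0..1} b0"
  have sm: "smooth_fun (\<lambda>t. complex_of_real (b0 t))"
    unfolding b0_def of_real_mult
    using smooth_affine_real[OF smooth_flat[of 1], of "-1" 1] by (intro smooth_mult smooth_flat) simp
  have cont: "continuous_on UNIV b0"
    using continuous_on_Re[OF smooth_continuous[OF sm]] by simp
  have nonneg: "b0 t \<ge> 0" for t by (auto simp: b0_def flat_def)
  have pos: "b0 t > 0" if "t \<in> {0<..<1}" for t using that by (auto simp: b0_def flat_def)
  have zero: "b0 t = 0" if "t \<notin> {0..1}" for t using that by (auto simp: b0_def flat_def)
  have "I \<noteq> 0"
    unfolding I_def using integral_eq_0_iff[of 0 1 b0] nonneg pos[of "1/2"] continuous_on_subset[OF cont]
    by fastforce
  moreover have "I \<ge> 0" unfolding I_def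
    by (intro integral_nonneg integrable_continuous_real continuous_on_subset[OF cont]) (auto simp: nonneg)
  ultimately have I: "I > 0" by simp
  show ?thesis
  proof (intro exI[of _ "\<lambda>t. b0 t / I"] conjI)
    show "smooth_fun (\<lambda>t. complex_of_real (b0 t / I))"
      using smooth_cmult[OF sm, of "1 / complex_of_real I"] by simp
    show "continuous_on UNIV (\<lambda>t. b0 t / I)" using I by (intro continuous_intros cont) auto
    show "integral {0..1} (\<lambda>t. b0 t / I) = 1" using I by (simp add: I_def)
  qed (use I nonneg pos zero in auto)
qed

section \<open>Slices and tensor products\<close>

lemma has_dirderiv_slice:
  "has_dirderiv (v, 0) f f' \<Longrightarrow> has_dirderiv v (\<lambda>x. f (x, r)) (\<lambda>x. f' (x, r))"
  by (simp add: has_dirderiv_def)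

lemma smooth_slice:
  fixes f :: "'a::euclidean_space \<times> 'b::euclidean_space \<Rightarrow> complex"
  assumes "smooth_fun f"
  shows "smooth_fun (\<lambda>x. f (x, r))"
proof (rule smooth_coinduct[where P="\<lambda>h. \<exists>f :: 'a \<times> 'b \<Rightarrow> complex. smooth_fun f \<and> h = (\<lambda>x. f (x, r))"])
  show "continuous_on UNIV h" if "\<exists>f :: 'a \<times> 'b \<Rightarrow> complex. smooth_fun f \<and> h = (\<lambda>x. f (x, r))" for h
    using that by (elim exE conjE, hypsubst) (erule smooth_continuous_compose, intro continuous_intros)
  fix h and v :: 'a
  assume "\<exists>f :: 'a \<times> 'b \<Rightarrow> complex. smooth_fun f \<and> h = (\<lambda>x. f (x, r))" and v: "v \<in> Basis"
  then obtain f :: "'a \<times> 'b \<Rightarrow> complex" where f: "smooth_fun f" "h = (\<lambda>x. f (x, r))" by blast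
  have "(v, 0) \<in> Basis" using v by (simp add: Basis_prod_def)
  then show "\<exists>h'. has_dirderiv v h h' \<and> (\<exists>f :: 'a \<times> 'b \<Rightarrow> complex. smooth_fun f \<and> h' = (\<lambda>x. f (x, r)))"
    using f has_dirderiv_slice[OF smooth_has_dirderiv] smooth_dirderiv by blast
qed (use assms in blast)

lemma iterpd_slice:
  fixes f :: "'a::euclidean_space \<times> 'b::euclidean_space \<Rightarrow> complex"
  assumes "smooth_fun f" "set xs \<subseteq> Basis"
  shows "iterpd xs (\<lambda>x. f (x, r)) = (\<lambda>x. iterpd (map (\<lambda>x. (x, 0)) xs) f (x, r))"
  using assms(2)
proof (induction xs)
  case (Cons v xs)
  then have "(v, 0::'b) \<in> Basis" "set (map (\<lambda>x. (x, 0::'b)) xs) \<subseteq> Basis" by (auto simp: Basis_prod_def)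
  then have "has_dirderiv (v, 0) (iterpd (map (\<lambda>x. (x, 0)) xs) f) (dirderiv (v, 0) (iterpd (map (\<lambda>x. (x, 0)) xs) f))"
    using smooth_has_dirderiv smooth_iterpd[OF assms(1)] by blast
  from dirderiv_eq[OF has_dirderiv_slice[OF this, of r]] show ?case using Cons by simp
qed simp

lemma smooth_tensor:
  fixes \<psi> :: "'a::euclidean_space \<Rightarrow> complex" and \<phi> :: "'b::euclidean_space \<Rightarrow> complex"
  assumes "smooth_fun \<psi>" "smooth_fun \<phi>"
  shows "smooth_fun (\<lambda>(x, t). \<psi> x * \<phi> t)"
  unfolding case_prod_unfold
proof (rule smooth_mult)
  show "smooth_fun (\<lambda>z. \<psi> (fst z))" "smooth_fun (\<lambda>z. \<phi> (snd z))"
    by (rule smooth_pullback[OF assms(1) linear_fst] smooth_pullback[OF assms(2) linear_snd];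
        auto simp: Basis_prod_def)+
qed

lemma test_tensor:
  fixes \<psi> :: "'a::euclidean_space \<Rightarrow> complex" and \<phi> :: "'b::euclidean_space \<Rightarrow> complex"
  assumes "test_fun \<psi>" "test_fun \<phi>"
  shows "test_fun (\<lambda>(x, t). \<psi> x * \<phi> t)"
proof -
  obtain R R' where R: "\<forall>x. norm x > R \<longrightarrow> \<psi> x = 0" "\<forall>x. norm x > R' \<longrightarrow> \<phi> x = 0"
    using assms unfolding test_fun_iff by blast
  have "(\<lambda>(x, t). \<psi> x * \<phi> t) z = 0" if "norm z > \<bar>R\<bar> + \<bar>R'\<bar>" for z
  proof -
    have "norm z \<le> norm (fst z) + norm (snd z)" by (metis norm_Pair_le prod.collapse)
    then have "norm (fst z) > R \<or> norm (snd z) > R'" using that by linarith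
    then show ?thesis using R by (auto simp: case_prod_unfold)
  qed
  then show ?thesis using smooth_tensor assms unfolding test_fun_iff by blast
qed

text \<open>Every basis vector of the product lies in one factor, and \<open>snd v = 0\<close> tells
  which, so a list of directions splits into those acting on \<open>\<psi>\<close> and those acting
  on \<open>\<phi>\<close>.\<close>

lemma iterpd_tensor:
  fixes \<psi> :: "'a::euclidean_space \<Rightarrow> complex" and \<phi> :: "'b::euclidean_space \<Rightarrow> complex"
  assumes "smooth_fun \<psi>" "smooth_fun \<phi>" "set vs \<subseteq> Basis"
  shows "iterpd vs (\<lambda>(x, t). \<psi> x * \<phi> t) = (\<lambda>(x, t).
    iterpd (map fst (filter (\<lambda>v. snd v = 0) vs)) \<psi> x * iterpd (map snd (filter (\<lambda>v. snd v \<noteq> 0) vs)) \<phi> t)"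
  using assms(3)
proof (induction vs)
  case (Cons v vs)
  let ?X = "map fst (filter (\<lambda>v. snd v = 0) vs)" and ?T = "map snd (filter (\<lambda>v. snd v \<noteq> 0) vs)"
  define f where "f = iterpd ?X \<psi>"
  define g where "g = iterpd ?T \<phi>"
  have "set ?X \<subseteq> Basis" "set ?T \<subseteq> Basis" using Cons by (auto simp: Basis_prod_def)
  then have sm: "smooth_fun f" "smooth_fun g" unfolding f_def g_def using smooth_iterpd assms by blast+
  have IH: "iterpd vs (\<lambda>(x, t). \<psi> x * \<phi> t) = (\<lambda>z. f (fst z) * g (snd z))"
    using Cons by (auto simp: f_def g_def)
  from Cons consider (1) b where "v = (b, 0)" "b \<in> Basis" | (2) c where "v = (0, c)" "c \<in> Basis"
    by (auto simp: Basis_prod_def)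
  then show ?case
  proof cases
    case 1
    have "has_dirderiv v (\<lambda>z. f (fst z)) (\<lambda>z. dirderiv b f (fst z))"
      using has_dirderiv_pullback[of fst v f, OF _ linear_fst] smooth_has_dirderiv[OF sm(1)] 1 by auto
    moreover have "has_dirderiv v (\<lambda>z. g (snd z)) (\<lambda>z. 0)"
      using 1 by (simp add: has_dirderiv_def)
    ultimately have "has_dirderiv v (\<lambda>z. f (fst z) * g (snd z)) (\<lambda>z. dirderiv b f (fst z) * g (snd z) + f (fst z) * 0)"
      by (rule has_dirderiv_mult)
    from dirderiv_eq[OF this] show ?thesis using 1 IH by (auto simp: f_def g_def)
  next
    case 2
    have "has_dirderiv v (\<lambda>z. g (snd z)) (\<lambda>z. dirderiv c g (snd z))"
      using has_dirderiv_pullback[of snd v g, OF _ linear_snd] smooth_has_dirderiv[OF sm(2)] 2 by auto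
    moreover have "has_dirderiv v (\<lambda>z. f (fst z)) (\<lambda>z. 0)"
      using 2 by (simp add: has_dirderiv_def)
    ultimately have "has_dirderiv v (\<lambda>z. f (fst z) * g (snd z)) (\<lambda>z. 0 * g (snd z) + f (fst z) * dirderiv c g (snd z))"
      by (intro has_dirderiv_mult)
    from dirderiv_eq[OF this] show ?thesis using 2 IH nonzero_Basis[of c] by (auto simp: f_def g_def)
  qed
qed auto

lemma iterpd_translate_family:
  assumes "smooth_fun f" "set vs \<subseteq> Basis"
  shows "iterpd vs (\<lambda>z. c r * f (z + r *\<^sub>R w)) = (\<lambda>z. c r * iterpd vs f (z + r *\<^sub>R w))"
  using assms by (simp add: iterpd_cmult iterpd_translate smooth_translate)

lemma smooth_family_translate:
  assumes f: "smooth_fun f" and c: "continuous_on UNIV c"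
  shows "smooth_family (\<lambda>r z. c r * f (z + r *\<^sub>R w))"
  unfolding smooth_family_def
proof (intro conjI allI impI)
  show "smooth_fun (\<lambda>z. c r * f (z + r *\<^sub>R w))" for r
    by (intro smooth_cmult smooth_translate f)
  fix vs :: "'a list" assume vs: "set vs \<subseteq> Basis"
  show "continuous_on UNIV (\<lambda>p. iterpd vs (\<lambda>z. c (fst p) * f (z + fst p *\<^sub>R w)) (snd p))"
    unfolding iterpd_translate_family[OF f vs]
    by (intro continuous_intros continuous_on_compose2[OF c] smooth_continuous_compose[OF smooth_iterpd[OF f vs]]) auto
qed

text \<open>Mollifying \<open>f\<close> in time only gives a function that is at once an average of small time translates of
  \<open>f\<close>, hence close to \<open>f\<close>, and an integral over tensor products, hence annihilated by \<open>u\<close>.\<close>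

lemma tensor_density:
  fixes u :: "('a::euclidean_space \<times> real \<Rightarrow> complex) \<Rightarrow> complex"
  assumes u: "distribution u"
    and u0: "\<And>\<psi> \<phi>. test_fun \<psi> \<Longrightarrow> test_fun \<phi> \<Longrightarrow> u (\<lambda>(x, t). \<psi> x * \<phi> t) = 0"
    and f: "test_fun f"
  shows "u f = 0"
proof -
  obtain b :: "real \<Rightarrow> real" where b: "smooth_fun (\<lambda>t. complex_of_real (b t))" "continuous_on UNIV b"
    "\<And>t. b t \<ge> 0" "\<And>t. t \<notin> {0..1} \<Longrightarrow> b t = 0" "\<And>t. t \<in> {0<..<1} \<Longrightarrow> b t > 0" "integral {0..1} b = 1"
    using bump_exists by blast
  obtain R0 where R0: "\<And>x. norm x > R0 \<Longrightarrow> f x = 0" using f unfolding test_fun_iff by blast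
  \<comment> \<open>The absolute value guarantees \<open>-R \<le> R\<close>, so that
    \<open>{-R..R}\<close> can serve as interval of integration at the end.\<close>
  define R where "R = \<bar>R0\<bar>"
  have R: "f x = 0" if "norm x > R" for x using R0 that by (auto simp: R_def)
  have smf: "smooth_fun f" using f by (rule test_smooth)
  define N where "N n = real (Suc n)" for n
  have N: "N n > 0" for n by (simp add: N_def)
  \<comment> \<open>A pure shift in time by \<open>-1 / N\<close>: \<open>F n\<close> below is the
    mean of \<open>f (x, t - r / N)\<close> with weight \<open>b r\<close>.\<close>
  define w :: "nat \<Rightarrow> 'a \<times> real" where "w n = (0, - inverse (N n))" for n
  have w1: "norm (r *\<^sub>R w n) \<le> inverse (N n)" if "r \<in> {0..1}" for r n
  proof -
    have "norm (r *\<^sub>R w n) = r * inverse (N n)" using that N[of n] by (simp add: w_def abs_mult)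
    also have "\<dots> \<le> 1 * inverse (N n)" using that N[of n] by (intro mult_right_mono) auto
    finally show ?thesis by simp
  qed
  have N1: "inverse (N n) \<le> 1" for n by (simp add: N_def inverse_le_1_iff)
  define K where "K n = (\<lambda>r z. complex_of_real (b r) * f (z + r *\<^sub>R w n))" for n
  have famK: "smooth_family (K n)" for n
    unfolding K_def by (intro smooth_family_translate smf continuous_intros b(2))
  define F where "F n = (\<lambda>z. integral {0..1} (\<lambda>r. K n r z))" for n
  have F0: "F n z = 0" if "norm z > R + 1" for n z
  proof -
    have "K n r z = 0" if r: "r \<in> {0..1}" for r
    proof -
      have "norm (z + r *\<^sub>R w n) > R"
        using norm_triangle_ineq4[of "z + r *\<^sub>R w n" "r *\<^sub>R w n"] w1[OF r, of n] N1[of n] \<open>norm z > R + 1\<close> by simp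
      then show ?thesis using R by (simp add: K_def)
    qed
    then show ?thesis
      using Henstock_Kurzweil_Integration.integral_cong[of "{0..1}" "\<lambda>r. K n r z" "\<lambda>r. 0"] by (simp add: F_def)
  qed
  have testF: "test_fun (F n)" for n
    unfolding test_fun_iff using F0 smooth_integral_family[OF famK] unfolding F_def by blast
  have "D_conv0 (\<lambda>n z. F n z - f z)"
  proof (rule D_conv0I[of _ "R + 1"])
    show "test_fun (\<lambda>z. F n z - f z)" for n by (intro test_diff testF f)
    show "F n z - f z = 0" if "norm z > R + 1" for n z using that R F0 by simp
    fix vs :: "('a \<times> real) list" and e :: real assume vs: "set vs \<subseteq> Basis" and e: "e > 0"
    define h where "h = iterpd vs f"
    have sh: "smooth_fun h" unfolding h_def by (intro smooth_iterpd vs smf)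
    have "uniformly_continuous_on UNIV h"
      using compact_support_uniformly_continuous[of h R] iterpd_eq_0_norm[of R f _ vs] R smooth_continuous[OF sh]
      by (simp add: h_def)
    then obtain d where d: "d > 0" "\<And>p q. dist q p < d \<Longrightarrow> dist (h q) (h p) < e"
      unfolding uniformly_continuous_on_def using e by (metis UNIV_I)
    have bound: "norm (iterpd vs (\<lambda>z. F n z - f z) z) \<le> e" if n: "inverse (N n) < d" for n z
    proof -
      have ci: "continuous_on {0..1} (\<lambda>r. complex_of_real (b r) * h (z + r *\<^sub>R w n))"
        "continuous_on {0..1} (\<lambda>r. complex_of_real (b r) * h z)"
        by (intro continuous_intros continuous_on_subset[OF b(2)] smooth_continuous_compose[OF sh]; simp)+
      \<comment> \<open>Total mass 1 allows \<open>h z\<close> to be moved under the integral, where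
        only increments of \<open>h\<close> over shifts of length at most \<open>1 / N\<close>
        remain.\<close>
      have "integral {0..1} (\<lambda>r. complex_of_real (b r)) = 1"
        using integral_linear[OF _ bounded_linear_of_real, of b "{0..1}"] b(6)
          integrable_continuous_real[OF continuous_on_subset[OF b(2)]] by (simp add: o_def)
      then have "h z = integral {0..1} (\<lambda>r. complex_of_real (b r) * h z)" by simp
      moreover have "iterpd vs (\<lambda>z. F n z - f z) z = integral {0..1} (\<lambda>r. complex_of_real (b r) * h (z + r *\<^sub>R w n)) - h z"
        using iterpd_diff[OF test_smooth[OF testF] smf vs, of n] iterpd_integral_family[OF famK vs, of 0 1 n]
          iterpd_translate_family[OF smf vs, of "\<lambda>r. complex_of_real (b r)"] by (simp add: F_def K_def h_def)
      ultimately have "iterpd vs (\<lambda>z. F n z - f z) z = integral {0..1} (\<lambda>r. complex_of_real (b r) * (h (z + r *\<^sub>R w n) - h z))"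
        using integral_diff[OF integrable_continuous_real[OF ci(1)] integrable_continuous_real[OF ci(2)]]
        by (simp only: right_diff_distrib)
      moreover have "norm (integral {0..1} (\<lambda>r. complex_of_real (b r) * (h (z + r *\<^sub>R w n) - h z))) \<le> integral {0..1} (\<lambda>r. b r * e)"
      proof (rule integral_norm_bound_integral)
        show "(\<lambda>r. complex_of_real (b r) * (h (z + r *\<^sub>R w n) - h z)) integrable_on {0..1}"
          using integrable_diff[OF integrable_continuous_real[OF ci(1)] integrable_continuous_real[OF ci(2)]]
          by (simp only: right_diff_distrib)
        show "(\<lambda>r. b r * e) integrable_on {0..1}"
          by (intro integrable_continuous_real continuous_intros continuous_on_subset[OF b(2)]) auto
        fix r :: real assume "r \<in> {0..1}"
        then have "norm (r *\<^sub>R w n) < d" using w1[of r n] n by linarith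
        then have "dist (z + r *\<^sub>R w n) z < d" by (simp add: dist_norm)
        then have "norm (h (z + r *\<^sub>R w n) - h z) \<le> e" using d(2) by (simp add: dist_norm less_imp_le)
        then show "norm (complex_of_real (b r) * (h (z + r *\<^sub>R w n) - h z)) \<le> b r * e"
          using b(3)[of r] by (simp add: norm_mult mult_left_mono)
      qed
      ultimately show ?thesis using b(6) by simp
    qed
    have "\<forall>\<^sub>F n in sequentially. inverse (N n) < d"
      unfolding N_def using LIMSEQ_inverse_real_of_nat d(1) by (rule order_tendstoD)
    then show "\<forall>\<^sub>F n in sequentially. \<forall>z. norm (iterpd vs (\<lambda>z. F n z - f z) z) \<le> e"
      by (rule eventually_mono) (use bound in blast)
  qed
  then have lim: "(\<lambda>n. u (\<lambda>z. F n z - f z)) \<longlonglongrightarrow> 0" by (rule distribution_conv0[OF u])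
  have "u (F n) = 0" for n
  proof -
    \<comment> \<open>The bump squeezed into \<open>{0..1/N}\<close>. After a substitution
      \<open>F n\<close> is the integral of \<open>f (x, r) * \<rho> (t - r)\<close> over
      \<open>r\<close>.\<close>
    define \<rho> where "\<rho> s = complex_of_real (N n) * complex_of_real (b (N n * s))" for s
    have sm\<rho>: "smooth_fun \<rho>"
      unfolding \<rho>_def using smooth_cmult[OF smooth_affine_real[OF b(1), of "N n" 0]] by simp
    have \<rho>0: "\<rho> s = 0" if "s \<notin> {0..inverse (N n)}" for s
    proof -
      have "N n * s \<notin> {0..1}" using that N[of n] by (auto simp: field_simps zero_le_mult_iff)
      then show ?thesis using b(4) by (simp add: \<rho>_def)
    qed
    \<comment> \<open>For fixed \<open>r\<close> a tensor product in \<open>(x, t)\<close>: the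
      slice of \<open>f\<close> at time \<open>r\<close> times a translate of
      \<open>\<rho>\<close>.\<close>
    define L where "L = (\<lambda>r z. f (fst z, r) * \<rho> (snd z - r))"
    have slice: "test_fun (\<lambda>x. f (x, r))" for r
    proof -
      have "f (x, r) = 0" if "norm x > R" for x
      proof (rule R)
        show "norm (x, r) > R" using norm_fst_le[of x r] that by linarith
      qed
      then show ?thesis unfolding test_fun_iff using smooth_slice[OF smf] by blast
    qed
    have test\<rho>: "test_fun (\<lambda>t. \<rho> (t - r))" for r
    proof -
      have "\<forall>x. norm x > 1 \<longrightarrow> \<rho> x = 0" using \<rho>0 N1[of n] by force
      then have "test_fun \<rho>" unfolding test_fun_iff using sm\<rho> by blast
      from test_translate[OF this, of "-r"] show ?thesis by simp
    qed
    have famL: "smooth_family L"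
      unfolding smooth_family_def
    proof (intro conjI allI impI)
      show "smooth_fun (L r)" for r
        using smooth_tensor[OF test_smooth[OF slice] test_smooth[OF test\<rho>], of r r] by (simp add: L_def case_prod_unfold)
      fix vs :: "('a \<times> real) list" assume vs: "set vs \<subseteq> Basis"
      let ?X = "map fst (filter (\<lambda>v. snd v = 0) vs)" and ?T = "map snd (filter (\<lambda>v. snd v \<noteq> 0) vs)"
      have XT: "set ?X \<subseteq> Basis" "set ?T \<subseteq> Basis" "set (map (\<lambda>x. (x, 0::real)) ?X) \<subseteq> Basis"
        using vs by (auto simp: Basis_prod_def)
      have eq: "iterpd vs (L r) z = iterpd (map (\<lambda>x. (x, 0)) ?X) f (fst z, r) * iterpd ?T \<rho> (snd z - r)" for r z
        using iterpd_tensor[OF test_smooth[OF slice] test_smooth[OF test\<rho>] vs, of r r]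
          iterpd_slice[OF smf XT(1), of r] iterpd_translate[OF sm\<rho> XT(2), of "-r"]
        by (simp add: L_def case_prod_unfold)
      show "continuous_on UNIV (\<lambda>p. iterpd vs (L (fst p)) (snd p))"
        unfolding eq
        by (intro continuous_on_mult smooth_continuous_compose[OF smooth_iterpd[OF smf XT(3)]]
            smooth_continuous_compose[OF smooth_iterpd[OF sm\<rho> XT(2)]] continuous_intros)
    qed
    \<comment> \<open>Two intervals capture the whole integrand \<open>G\<close>: one moving with
      \<open>t\<close>, from the support of \<open>\<rho>\<close>, and the fixed
      \<open>{-R..R}\<close>, from the support of \<open>f\<close>. The first fits the change of
      variables, the second fits \<open>distribution_integral_eq_0\<close>, whose interval may not
      depend on the point.\<close>
    have "F n z = integral {-R..R} (\<lambda>r. L r z)" for z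
    proof -
      obtain x t where z: "z = (x, t)" by (cases z)
      let ?i = "inverse (N n)"
      define G where "G r = f (x, r) * \<rho> (t - r)" for r
      have G1: "(\<lambda>r. if r \<in> {-R..R} then G r else 0) = G"
      proof
        fix r show "(if r \<in> {-R..R} then G r else 0) = G r"
          using R[of "(x, r)"] norm_snd_le[of r x] by (auto simp: G_def)
      qed
      have G2: "(\<lambda>r. if r \<in> {t - ?i..t} then G r else 0) = G"
        using \<rho>0 by (auto simp: G_def fun_eq_iff)
      have "integral {-R..R} G = integral UNIV G" using integral_restrict_UNIV[of "{-R..R}" G] G1 by simp
      also have "\<dots> = integral {t - ?i..t} G" using integral_restrict_UNIV[of "{t - ?i..t}" G] G2 by simp
      finally have eq: "integral {-R..R} G = integral {t - ?i..t} G" .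
      have "continuous_on S G" for S
        unfolding G_def
        by (intro continuous_on_mult smooth_continuous_compose[OF sm\<rho>] smooth_continuous_compose[OF smf] continuous_intros)
      then have "(G has_integral integral {t - ?i..t} G) (cbox (t - ?i) t)"
        by (simp add: cbox_interval integrable_continuous_real integrable_integral)
      from has_integral_affinity[OF this, of "- ?i" t]
      have "((\<lambda>q. G (- ?i * q + t)) has_integral N n *\<^sub>R integral {t - ?i..t} G)
          ((\<lambda>q. - N n * q + N n * t) ` {t - ?i..t})"
        using N[of n] by (simp add: cbox_interval divide_inverse mult.commute)
      moreover have "(\<lambda>q. - N n * q + N n * t) ` {t - ?i..t} = {0..1}"
        using image_affinity_atLeastAtMost[of "- N n" "N n * t" "t - ?i" t] N[of n] by (simp add: field_simps)
      ultimately have *: "((\<lambda>q. G (t - ?i * q)) has_integral complex_of_real (N n) * integral {t - ?i..t} G) {0..1}"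
        by (simp add: scaleR_conv_of_real)
      have "K n q z = inverse (complex_of_real (N n)) * G (t - ?i * q)" for q
        using N[of n] by (simp add: K_def G_def z w_def \<rho>_def field_simps)
      then have "F n z = inverse (complex_of_real (N n)) * (complex_of_real (N n) * integral {t - ?i..t} G)"
        unfolding F_def using integral_unique[OF *] by simp
      then have "F n z = integral {-R..R} G" using eq N[of n] by simp
      then show ?thesis by (simp add: L_def G_def[abs_def] z)
    qed
    then have "F n = (\<lambda>z. integral {-R..R} (\<lambda>r. L r z))" by auto
    moreover have "u (\<lambda>z. integral {-R..R} (\<lambda>r. L r z)) = 0"
    \<comment> \<open>The radius adds up the bounds for the time coordinate (\<open>R + 1\<close>),
      the space coordinate (\<open>R\<close>) and the parameter (\<open>R\<close>).\<close>
    proof (rule distribution_integral_eq_0[OF u famL, of "R + 1 + R + R"])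
      fix r :: real and z :: "'a \<times> real" assume nz: "norm (r, z) > R + 1 + R + R"
      show "L r z = 0"
      proof (rule ccontr)
        assume "L r z \<noteq> 0"
        then have "f (fst z, r) \<noteq> 0" "\<rho> (snd z - r) \<noteq> 0" by (auto simp: L_def)
        then have 1: "norm (fst z, r) \<le> R" and 2: "snd z - r \<in> {0..inverse (N n)}" using R \<rho>0 by force+
        have "norm (fst z) \<le> R" "norm r \<le> R"
          using 1 norm_fst_le[of "fst z" r] norm_snd_le[of r "fst z"] by auto
        moreover have "norm (snd z) \<le> R + 1" using 2 N1[of n] \<open>norm r \<le> R\<close> by auto
        moreover have "norm (r, z) \<le> norm r + (norm (fst z) + norm (snd z))"
          using norm_Pair_le[of r z] norm_Pair_le[of "fst z" "snd z"] by simp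
        ultimately show False using nz by linarith
      qed
    next
      show "u (L r) = 0" for r
        using u0[OF slice test\<rho>, of r r] by (simp add: L_def case_prod_unfold)
    qed (simp add: R_def)
    ultimately show ?thesis by simp
  qed
  then have "u (\<lambda>z. F n z - f z) = - u f" for n using distribution_diff[OF u testF f] by simp
  then show ?thesis using lim by (simp add: LIMSEQ_const_iff)
qed

section \<open>Fourier uniqueness and ordinary differential equations\<close>

text \<open>The even part of \<open>h\<close> is a continuous function of \<open>cos\<close>, hence a uniform limit of polynomials in \<open>cos\<close>.\<close>

lemma cos_moments_zero:
  fixes h :: "real \<Rightarrow> real"
  assumes cont: "continuous_on UNIV h"
    and mom: "\<And>n. integral {-pi..pi} (\<lambda>\<theta>. h \<theta> * cos \<theta> ^ n) = 0"
  shows "h 0 = 0"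
proof -
  \<comment> \<open>Twice the even part of \<open>h\<close>. Powers of \<open>cos\<close> see
    nothing else, and nothing is lost at 0, where \<open>e 0 = 2 * h 0\<close>.\<close>
  define e where "e \<theta> = h \<theta> + h (- \<theta>)" for \<theta>
  have ch: "continuous_on S (\<lambda>\<theta>. h (- \<theta>))" for S
    by (rule continuous_on_compose2[OF cont]) (auto intro!: continuous_intros)
  have ce: "continuous_on S e" for S
    unfolding e_def by (intro continuous_intros ch continuous_on_subset[OF cont]) auto
  have mom_e: "integral {-pi..pi} (\<lambda>\<theta>. e \<theta> * cos \<theta> ^ n) = 0" for n
  proof -
    have "integral {-pi..pi} (\<lambda>\<theta>. h (- \<theta>) * cos \<theta> ^ n) = 0"
      using Henstock_Kurzweil_Integration.integral_reflect_real[of pi "-pi" "\<lambda>\<theta>. h \<theta> * cos \<theta> ^ n"] mom[of n] by simp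
    moreover have "integral {-pi..pi} (\<lambda>\<theta>. h \<theta> * cos \<theta> ^ n + h (- \<theta>) * cos \<theta> ^ n)
       = integral {-pi..pi} (\<lambda>\<theta>. h \<theta> * cos \<theta> ^ n) + integral {-pi..pi} (\<lambda>\<theta>. h (- \<theta>) * cos \<theta> ^ n)"
      by (intro Henstock_Kurzweil_Integration.integral_add integrable_continuous_real continuous_intros ch continuous_on_subset[OF cont]) auto
    ultimately show ?thesis using mom[of n] by (simp add: e_def algebra_simps)
  qed
  define F where "F x = e (arccos x)" for x
  have cF: "continuous_on {-1..1} F"
    unfolding F_def by (rule continuous_on_compose2[OF ce[of UNIV] continuous_on_arccos']) auto
  have F: "F (cos \<theta>) = e \<theta>" if "\<theta> \<in> {-pi..pi}" for \<theta>
  proof (cases "\<theta> \<ge> 0")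
    case True then show ?thesis using that by (simp add: F_def arccos_cos)
  next
    case False
    then have "arccos (cos \<theta>) = - \<theta>" using that by (simp add: arccos_cos2)
    then show ?thesis by (simp add: F_def e_def)
  qed
  have ii: "(\<lambda>\<theta>. e \<theta> * e \<theta>) integrable_on {-pi..pi}" "(\<lambda>\<theta>. \<bar>e \<theta>\<bar>) integrable_on {-pi..pi}"
    by (intro integrable_continuous_real continuous_intros ce)+
  have "integral {-pi..pi} (\<lambda>\<theta>. e \<theta> * e \<theta>) \<le> 0 + \<epsilon>" if \<epsilon>: "\<epsilon> > 0" for \<epsilon>
  proof -
    define I where "I = integral {-pi..pi} (\<lambda>\<theta>. \<bar>e \<theta>\<bar>)"
    have "I \<ge> 0" unfolding I_def by (intro Henstock_Kurzweil_Integration.integral_nonneg ii) auto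
    \<comment> \<open>Orthogonality to polynomials in \<open>cos\<close> turns the integral of
      \<open>e^2\<close> into that of \<open>e * (e - q o cos)\<close>, which is at most
      \<open>I * \<delta>\<close>. Adding 1 avoids a division by 0.\<close>
    define \<delta> where "\<delta> = \<epsilon> / (I + 1)"
    have \<delta>: "\<delta> > 0" "I * \<delta> \<le> \<epsilon>" using \<epsilon> \<open>I \<ge> 0\<close> by (auto simp: \<delta>_def field_simps)
    obtain q where q: "real_polynomial_function q" "\<And>x. x \<in> {-1..1} \<Longrightarrow> \<bar>F x - q x\<bar> < \<delta>"
      using Stone_Weierstrass_real_polynomial_function[OF _ cF \<delta>(1)] by auto
    obtain c n where cn: "q = (\<lambda>x. \<Sum>i\<le>n. c i * x ^ i)"
      using real_polynomial_function_imp_sum[OF q(1)] by auto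
    have cq: "continuous_on S (\<lambda>\<theta>. e \<theta> * q (cos \<theta>))" for S
      unfolding cn by (intro continuous_intros ce)
    have "integral {-pi..pi} (\<lambda>\<theta>. e \<theta> * q (cos \<theta>)) = integral {-pi..pi} (\<lambda>\<theta>. \<Sum>i\<le>n. c i * (e \<theta> * cos \<theta> ^ i))"
      unfolding cn by (simp add: sum_distrib_left mult_ac)
    also have "\<dots> = (\<Sum>i\<le>n. integral {-pi..pi} (\<lambda>\<theta>. c i * (e \<theta> * cos \<theta> ^ i)))"
      by (intro Henstock_Kurzweil_Integration.integral_sum integrable_continuous_real continuous_intros ce) auto
    also have "\<dots> = 0" using mom_e by simp
    finally have "integral {-pi..pi} (\<lambda>\<theta>. e \<theta> * e \<theta>) = integral {-pi..pi} (\<lambda>\<theta>. e \<theta> * e \<theta> - e \<theta> * q (cos \<theta>))"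
      using Henstock_Kurzweil_Integration.integral_diff[OF ii(1) integrable_continuous_real[OF cq]] by simp
    also have "\<dots> \<le> integral {-pi..pi} (\<lambda>\<theta>. \<bar>e \<theta>\<bar> * \<delta>)"
    proof (intro Henstock_Kurzweil_Integration.integral_le Henstock_Kurzweil_Integration.integrable_diff ii(1) integrable_continuous_real[OF cq])
      show "(\<lambda>\<theta>. \<bar>e \<theta>\<bar> * \<delta>) integrable_on {-pi..pi}" by (intro integrable_continuous_real continuous_intros ce)
      fix \<theta> assume \<theta>: "\<theta> \<in> {-pi..pi}"
      have "\<bar>e \<theta> - q (cos \<theta>)\<bar> \<le> \<delta>" using q(2)[of "cos \<theta>"] F[OF \<theta>] by simp
      then have "\<bar>e \<theta>\<bar> * \<bar>e \<theta> - q (cos \<theta>)\<bar> \<le> \<bar>e \<theta>\<bar> * \<delta>" by (rule mult_left_mono) simp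
      moreover have "e \<theta> * e \<theta> - e \<theta> * q (cos \<theta>) \<le> \<bar>e \<theta>\<bar> * \<bar>e \<theta> - q (cos \<theta>)\<bar>"
        by (metis abs_ge_self abs_mult right_diff_distrib)
      ultimately show "e \<theta> * e \<theta> - e \<theta> * q (cos \<theta>) \<le> \<bar>e \<theta>\<bar> * \<delta>" by linarith
    qed
    also have "\<dots> \<le> \<epsilon>" using \<delta>(2) by (simp add: I_def)
    finally show ?thesis by simp
  qed
  then have "integral {-pi..pi} (\<lambda>\<theta>. e \<theta> * e \<theta>) \<le> 0" by (rule field_le_epsilon)
  moreover have "integral {-pi..pi} (\<lambda>\<theta>. e \<theta> * e \<theta>) \<ge> 0"
    by (intro Henstock_Kurzweil_Integration.integral_nonneg ii) auto
  ultimately have "integral {-pi..pi} (\<lambda>\<theta>. e \<theta> * e \<theta>) = 0" by simp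
  moreover have "continuous_on {-pi..pi} (\<lambda>\<theta>. e \<theta> * e \<theta>)" by (intro continuous_intros ce)
  ultimately have "\<forall>\<theta>\<in>{-pi..pi}. e \<theta> * e \<theta> = 0"
    using integral_eq_0_iff[of "-pi" pi "\<lambda>\<theta>. e \<theta> * e \<theta>"] by simp
  then have "e 0 * e 0 = 0" by simp
  then show ?thesis by (simp add: e_def)
qed

text \<open>Multiplication by \<open>cos\<close> averages the two neighbouring frequencies, so
  vanishing coefficients persist under products with powers of \<open>cos\<close>; then
  \<open>cos_moments_zero\<close> applies to the real and the imaginary part.\<close>

lemma fourier_coefficients_zero:
  fixes h :: "real \<Rightarrow> complex"
  assumes cont: "continuous_on UNIV h"
    and coef: "\<And>m::int. integral {-pi..pi} (\<lambda>\<theta>. cis (- (of_int m * \<theta>)) * h \<theta>) = 0"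
  shows "h 0 = 0"
proof -
  have ch: "continuous_on S h" for S using cont continuous_on_subset by blast
  have "integral {-pi..pi} (\<lambda>\<theta>. cis (- (of_int m * \<theta>)) * h \<theta> * complex_of_real (cos \<theta> ^ n)) = 0" for n and m :: int
  proof (induction n arbitrary: m)
    case 0 then show ?case using coef by simp
  next
    case (Suc n)
    define G where "G m \<theta> = cis (- (real_of_int m * \<theta>)) * h \<theta> * complex_of_real (cos \<theta> ^ n)" for m \<theta>
    have iG: "(\<lambda>\<theta>. (1/2) * G m \<theta>) integrable_on {-pi..pi}" for m
      unfolding G_def cis_conv_exp by (intro integrable_continuous_real continuous_intros ch)
    have "cis (- (of_int m * \<theta>)) * h \<theta> * complex_of_real (cos \<theta> ^ Suc n) = (1/2) * G (m - 1) \<theta> + (1/2) * G (m + 1) \<theta>" for \<theta>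
    proof -
      have "complex_of_real (cos \<theta>) = (cis \<theta> + cis (- \<theta>)) / 2"
        by (simp add: complex_eq_iff)
      moreover have "cis (- (of_int (m - 1) * \<theta>)) = cis (- (of_int m * \<theta>)) * cis \<theta>"
        "cis (- (of_int (m + 1) * \<theta>)) = cis (- (of_int m * \<theta>)) * cis (- \<theta>)"
        by (simp_all add: cis_mult algebra_simps)
      ultimately show ?thesis by (simp add: G_def algebra_simps add_divide_distrib)
    qed
    then have "integral {-pi..pi} (\<lambda>\<theta>. cis (- (of_int m * \<theta>)) * h \<theta> * complex_of_real (cos \<theta> ^ Suc n)) =
      integral {-pi..pi} (\<lambda>\<theta>. (1/2) * G (m - 1) \<theta>) + integral {-pi..pi} (\<lambda>\<theta>. (1/2) * G (m + 1) \<theta>)"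
      using Henstock_Kurzweil_Integration.integral_add[OF iG iG] by simp
    then show ?case using Suc.IH[of "m - 1"] Suc.IH[of "m + 1"] by (simp add: G_def)
  qed
  from this[of 0] have mom: "integral {-pi..pi} (\<lambda>\<theta>. h \<theta> * complex_of_real (cos \<theta> ^ n)) = 0" for n by simp
  have int: "(\<lambda>\<theta>. h \<theta> * complex_of_real (cos \<theta> ^ n)) integrable_on {-pi..pi}" for n
    by (intro integrable_continuous_real continuous_intros ch)
  have "integral {-pi..pi} (\<lambda>\<theta>. Re (h \<theta>) * cos \<theta> ^ n) = 0" for n
    using integral_linear[OF int[of n] bounded_linear_Re] mom[of n] by (simp add: o_def)
  then have "Re (h 0) = 0"
    by (intro cos_moments_zero[of "\<lambda>\<theta>. Re (h \<theta>)"] continuous_intros ch)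
  moreover have "integral {-pi..pi} (\<lambda>\<theta>. Im (h \<theta>) * cos \<theta> ^ n) = 0" for n
    using integral_linear[OF int[of n] bounded_linear_Im] mom[of n] by (simp add: o_def)
  then have "Im (h 0) = 0"
    by (intro cos_moments_zero[of "\<lambda>\<theta>. Im (h \<theta>)"] continuous_intros ch)
  ultimately show ?thesis by (simp add: complex_eq_iff)
qed

text \<open>As a function of the shift \<open>s\<close>, the integral has derivative
  \<open>g (pi + s) - g (-pi + s)\<close>, which is 0 by periodicity.\<close>

lemma integral_periodic_shift:
  fixes g :: "real \<Rightarrow> complex"
  assumes cont: "continuous_on UNIV g" and per: "\<And>x. g (x + 2 * pi) = g x"
  shows "integral {-pi..pi} (\<lambda>x. g (x + c)) = integral {-pi..pi} g"
proof -
  have cg: "continuous_on S g" for S using cont continuous_on_subset by blast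
  \<comment> \<open>\<open>{a..b}\<close> contains the shifted interval for every shift of size at
    most \<open>\<bar>c\<bar>\<close>, so one primitive \<open>A\<close> serves them all.\<close>
  define a where "a = -pi - \<bar>c\<bar>"
  define b where "b = pi + \<bar>c\<bar>"
  define A where "A y = integral {a..y} g" for y
  define D where "D s = A (pi + s) - A (-pi + s)" for s
  have dA: "(A has_vector_derivative g y) (at y within {a..b})" if "y \<in> {a..b}" for y
    unfolding A_def by (rule integral_has_vector_derivative[OF cg that])
  let ?S = "{-\<bar>c\<bar>..\<bar>c\<bar>}"
  have "(D has_vector_derivative 0) (at s within ?S)" if s: "s \<in> ?S" for s
  proof -
    have *: "((\<lambda>s. A (r + s)) has_vector_derivative g (r + s)) (at s within ?S)" if "r = pi \<or> r = -pi" for r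
    proof -
      have sub: "r + q \<in> {a..b}" if "q \<in> ?S" for q
      proof -
        have "- \<bar>c\<bar> \<le> q" "q \<le> \<bar>c\<bar>" using that by auto
        then show ?thesis
          unfolding a_def b_def atLeastAtMost_iff using \<open>r = pi \<or> r = -pi\<close> pi_ge_zero by linarith
      qed
      have "(A has_vector_derivative g (r + s)) (at (r + s) within (\<lambda>s. r + s) ` ?S)"
        by (rule has_vector_derivative_within_subset[OF dA]) (use sub s in blast, use sub in blast)
      then have "(A \<circ> (\<lambda>s. r + s) has_vector_derivative 1 *\<^sub>R g (r + s)) (at s within ?S)"
        by (intro vector_diff_chain_within) (auto intro!: derivative_eq_intros)
      then show ?thesis by (simp add: o_def)
    qed
    have "(D has_vector_derivative g (pi + s) - g (-pi + s)) (at s within ?S)"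
      unfolding D_def by (intro has_vector_derivative_diff *) auto
    then show ?thesis using per[of "-pi + s"] by (simp add: algebra_simps)
  qed
  then obtain k where "\<And>s. s \<in> ?S \<Longrightarrow> D s = k"
    using has_vector_derivative_zero_constant[of ?S D] by auto
  moreover have "c \<in> ?S" "0 \<in> ?S" by auto
  ultimately have "D c = D 0" by metis
  have "D s = integral {-pi + s..pi + s} g" if "s \<in> ?S" for s
    using Henstock_Kurzweil_Integration.integral_combine[of a "-pi + s" "pi + s" g] integrable_continuous_real[OF cg] that
    by (simp add: D_def A_def a_def add.commute diff_eq_eq)
  from this[of c] this[of 0] \<open>D c = D 0\<close> have "integral {-pi + c..pi + c} g = integral {-pi..pi} g" by (simp add: abs_if)
  moreover have "integral {-pi..pi} (\<lambda>x. g (x + c)) = integral {-pi + c..pi + c} g"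
    using integral_shift[OF cg, of "-pi" pi c] by (simp add: o_def)
  ultimately show ?thesis by simp
qed

text \<open>The operator \<open>q(d/ds)\<close> is taken apart into linear factors by induction on
  the degree. A factor \<open>d/ds - z\<close> annihilates only multiples of an exponential, and
  these vanish beyond \<open>S\<close> only if they are 0.\<close>

lemma ode_zero:
  fixes \<gamma> :: "nat \<Rightarrow> real \<Rightarrow> complex" and q :: "complex poly"
  assumes deriv: "\<And>j s. (\<gamma> j has_vector_derivative \<gamma> (Suc j) s) (at s)"
    and zero: "\<And>j s. s > S \<Longrightarrow> \<gamma> j s = 0"
    and "q \<noteq> 0" and "\<And>s. (\<Sum>j\<le>degree q. coeff q j * \<gamma> j s) = 0"
  shows "\<gamma> 0 s = 0"
  using assms(3,4)
proof (induction "degree q" arbitrary: q)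
  case 0
  then have "coeff q 0 * \<gamma> 0 s = 0" by (metis (no_types, lifting) atMost_0 empty_iff finite.emptyI sum.empty sum.insert add.right_neutral)
  moreover have "coeff q 0 \<noteq> 0" using 0 by (metis leading_coeff_0_iff)
  ultimately show ?case by simp
next
  case (Suc n)
  have "\<not> constant (poly q)" using Suc(2) by (simp add: constant_degree)
  then obtain z where "poly q z = 0" using fundamental_theorem_of_algebra by blast
  then obtain r where r: "q = [:-z, 1:] * r" by (auto simp: poly_eq_0_iff_dvd dvd_def)
  then have r0: "r \<noteq> 0" using Suc(3) by auto
  have "degree q = 1 + degree r" unfolding r using r0 by (subst degree_mult_eq) auto
  then have dr: "degree r = n" using Suc(2) by simp
  \<comment> \<open>\<open>w\<close> is \<open>r(d/ds)\<close> applied to \<open>\<gamma> 0\<close>,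
    so the equation for \<open>q\<close> reads \<open>w' = z w\<close>.\<close>
  define w where "w s = (\<Sum>j\<le>n. coeff r j * \<gamma> j s)" for s
  define w' where "w' s = (\<Sum>j\<le>n. coeff r j * \<gamma> (Suc j) s)" for s
  have dw: "(w has_vector_derivative w' s) (at s)" for s
    unfolding w_def w'_def by (intro has_vector_derivative_sum has_vector_derivative_mult_right deriv)
  have "w' s - z * w s = 0" for s
  proof -
    have q: "q = pCons 0 r - smult z r" unfolding r by simp
    have "(\<Sum>j\<le>Suc n. coeff (pCons 0 r) j * \<gamma> j s) = w' s"
      unfolding w'_def by (subst sum.atMost_Suc_shift) simp
    moreover have "(\<Sum>j\<le>Suc n. coeff r j * \<gamma> j s) = w s"
      unfolding w_def using dr by (simp add: coeff_eq_0)
    moreover have "(\<Sum>j\<le>Suc n. coeff q j * \<gamma> j s) = (\<Sum>j\<le>Suc n. coeff (pCons 0 r) j * \<gamma> j s) - z * (\<Sum>j\<le>Suc n. coeff r j * \<gamma> j s)"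
      unfolding q by (simp only: coeff_diff coeff_smult left_diff_distrib sum_subtractf sum_distrib_left mult.assoc)
    ultimately show ?thesis using Suc(4)[of s] Suc(2) by simp
  qed
  then have w': "w' s = z * w s" for s by (simp add: algebra_simps)
  \<comment> \<open>Integrating factor: the product is constant, and its value at
    \<open>S + 1\<close> is 0.\<close>
  have "((\<lambda>s. exp (- z * complex_of_real s) * w s) has_vector_derivative 0) (at s)" for s
  proof -
    have "((\<lambda>s. exp (- z * complex_of_real s)) has_vector_derivative (- z) * exp (- z * complex_of_real s)) (at s)"
    proof -
      have "((\<lambda>x. exp (- z * x)) has_field_derivative (- z) * exp (- z * complex_of_real s)) (at (complex_of_real s))"
        by (auto intro!: derivative_eq_intros)
      then show ?thesis by (rule has_vector_derivative_real_field)
    qed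
    from has_vector_derivative_mult[OF this dw[of s]] show ?thesis by (simp add: w' algebra_simps)
  qed
  then obtain k where k: "\<And>s. exp (- z * complex_of_real s) * w s = k"
    using has_vector_derivative_zero_constant[of UNIV "\<lambda>s. exp (- z * complex_of_real s) * w s"] by auto
  have "w (S + 1) = 0" unfolding w_def by (simp add: zero)
  then have "k = 0" using k[of "S + 1"] by simp
  then have "w s = 0" for s using k[of s] by simp
  then show ?case using Suc(1)[of r] dr r0 by (simp add: w_def)
qed

text \<open>Up to the factor \<open>2 pi\<close>, the \<open>m\<close>-th Fourier coefficient of
  \<open>g\<close> along the line through \<open>z\<close> in direction \<open>w\<close>. As a
  function of \<open>z\<close> it is the component of a periodic \<open>g\<close> of frequency
  \<open>m\<close> in that direction.\<close>

definition fourier_average :: "'a::euclidean_space \<Rightarrow> int \<Rightarrow> ('a \<Rightarrow> complex) \<Rightarrow> 'a \<Rightarrow> complex" where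
  "fourier_average w m g z = integral {-pi..pi} (\<lambda>\<theta>. cis (- (of_int m * \<theta>)) * g (z + \<theta> *\<^sub>R w))"

lemma fourier_average_family:
  "smooth_fun g \<Longrightarrow> smooth_family (\<lambda>\<theta> z. cis (- (of_int m * \<theta>)) * g (z + \<theta> *\<^sub>R w))"
  by (rule smooth_family_translate) (auto simp: cis_conv_exp intro!: continuous_intros)

lemma smooth_fourier_average: "smooth_fun g \<Longrightarrow> smooth_fun (fourier_average w m g)"
  unfolding fourier_average_def[abs_def] by (rule smooth_integral_family[OF fourier_average_family])

lemma iterpd_fourier_average:
  assumes "smooth_fun g" "set vs \<subseteq> Basis"
  shows "iterpd vs (fourier_average w m g) = fourier_average w m (iterpd vs g)"
  unfolding fourier_average_def[abs_def] iterpd_integral_family[OF fourier_average_family[OF assms(1)] assms(2)]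
    iterpd_translate_family[OF assms, of "\<lambda>\<theta>. cis (- (of_int m * \<theta>))"] ..

text \<open>Averaging commutes with translations. The factor 1 yields preservation of periods,
  factors \<open>cis\<close> preservation of the characters reached in other directions.\<close>

lemma fourier_average_translate:
  assumes "\<And>z. g (z + v) = c * g z"
  shows "fourier_average w m g (z + v) = c * fourier_average w m g z"
proof -
  have "g (z + v + \<theta> *\<^sub>R w) = c * g (z + \<theta> *\<^sub>R w)" for \<theta>
    using assms[of "z + \<theta> *\<^sub>R w"] by (simp add: add_ac)
  then show ?thesis unfolding fourier_average_def by (simp add: mult.left_commute[of _ c])
qed

text \<open>Moving \<open>z\<close> along \<open>w\<close> shifts the integration variable, which is
  harmless for a periodic integrand and costs a phase.\<close>

lemma fourier_average_character:
  assumes g: "continuous_on UNIV g" and per: "\<And>z. g (z + (2 * pi) *\<^sub>R w) = g z"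
  shows "fourier_average w m g (z + c *\<^sub>R w) = cis (of_int m * c) * fourier_average w m g z"
proof -
  define G where "G \<theta> = cis (- (of_int m * \<theta>)) * g (z + \<theta> *\<^sub>R w)" for \<theta>
  have "continuous_on UNIV G"
    unfolding G_def cis_conv_exp by (intro continuous_intros continuous_on_compose2[OF g]) auto
  moreover have "G (\<theta> + 2 * pi) = G \<theta>" for \<theta>
  proof -
    have "cis (- (of_int m * (\<theta> + 2 * pi))) = cis (- (of_int m * \<theta>)) * cis (2 * pi * of_int (- m))"
      by (simp add: cis_mult algebra_simps)
    also have "cis (2 * pi * of_int (- m)) = 1" by (rule cis_multiple_2pi) simp
    finally show ?thesis using per[of "z + \<theta> *\<^sub>R w"] by (simp add: G_def scaleR_add_left add.assoc)
  qed
  ultimately have "integral {-pi..pi} (\<lambda>\<theta>. G (\<theta> + c)) = integral {-pi..pi} G"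
    by (rule integral_periodic_shift)
  moreover have "cis (- (of_int m * \<theta>)) * g (z + c *\<^sub>R w + \<theta> *\<^sub>R w) = cis (of_int m * c) * G (\<theta> + c)" for \<theta>
  proof -
    have "cis (of_int m * c) * cis (- (of_int m * (\<theta> + c))) = cis (- (of_int m * \<theta>))"
      by (simp add: cis_mult algebra_simps)
    moreover have "z + c *\<^sub>R w + \<theta> *\<^sub>R w = z + (\<theta> + c) *\<^sub>R w" by (simp add: scaleR_add_left add_ac)
    ultimately show ?thesis by (simp only: G_def mult.assoc[symmetric])
  qed
  ultimately show ?thesis
    by (simp add: fourier_average_def G_def[abs_def])
qed

lemma fourier_average_unique:
  assumes g: "continuous_on UNIV g" and "\<And>m. fourier_average w m g z = 0"
  shows "g z = 0"
proof -
  have "g (z + 0 *\<^sub>R w) = 0"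
    using assms(2) unfolding fourier_average_def
    by (intro fourier_coefficients_zero[of "\<lambda>\<theta>. g (z + \<theta> *\<^sub>R w)"] continuous_on_compose2[OF g] continuous_intros) auto
  then show ?thesis by simp
qed

text \<open>Fourier analysis one direction at a time: averaging against characters in one direction preserves
  the class and the characters already obtained, so only functions that are characters in every
  direction have to be considered.\<close>

lemma fourier_reduction:
  fixes w :: "'k::finite \<Rightarrow> 'a::euclidean_space"
  assumes cont: "\<And>g. Q g \<Longrightarrow> continuous_on UNIV g"
    and per: "\<And>g k z. Q g \<Longrightarrow> g (z + (2 * pi) *\<^sub>R w k) = g z"
    and avg: "\<And>g k m. Q g \<Longrightarrow> Q (fourier_average (w k) m g)"
    and base: "\<And>g m. Q g \<Longrightarrow> (\<And>k z c. g (z + c *\<^sub>R w k) = cis (of_int (m k) * c) * g z) \<Longrightarrow> g = (\<lambda>_. 0)"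
    and "Q g"
  shows "g = (\<lambda>_. 0)"
proof -
  have "g = (\<lambda>_. 0)" if "Q g" "\<And>k z c. k \<in> J \<Longrightarrow> g (z + c *\<^sub>R w k) = cis (of_int (m k) * c) * g z"
    for J m g
    using that
  \<comment> \<open>\<open>J\<close> collects the directions in which \<open>g\<close> already is a
    character; the induction counts the remaining ones.\<close>
  proof (induction "card (- J)" arbitrary: J m g)
    case 0
    then have "- J = {}" by simp
    then have "J = UNIV" by blast
    then show ?case using base[OF 0(2), of m] 0(3) by blast
  next
    case (Suc n)
    then obtain k where k: "k \<notin> J" by (metis ComplI UNIV_eq_I card.empty compl_le_swap1 nat.distinct(1) Compl_UNIV_eq)
    have card: "n = card (- insert k J)"
    proof -
      have "- insert k J = - J - {k}" by auto
      then show ?thesis using Suc(2) k by (simp add: card_Diff_singleton)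
    qed
    have "fourier_average (w k) l g = (\<lambda>_. 0)" for l
    proof (rule Suc(1)[OF card, of _ "m(k := l)"])
      show "Q (fourier_average (w k) l g)" by (rule avg[OF Suc(3)])
      fix i z c assume i: "i \<in> insert k J"
      show "fourier_average (w k) l g (z + c *\<^sub>R w i) = cis (of_int ((m(k := l)) i) * c) * fourier_average (w k) l g z"
      proof (cases "i = k")
        case True
        then show ?thesis using fourier_average_character[OF cont[OF Suc(3)] per[OF Suc(3)]] by simp
      next
        case False
        then show ?thesis using i by (simp add: fourier_average_translate Suc(4))
      qed
    qed
    then show ?case using fourier_average_unique[OF cont[OF Suc(3)], of "w k"] by (metis (no_types, lifting) ext)
  qed
  from this[OF \<open>Q g\<close>, of "{}"] show ?thesis by blast
qed

section \<open>Triviality of the kernel\<close>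

lemma has_vector_derivative_cis:
  "((\<lambda>s. cis (c * s)) has_vector_derivative \<i> * complex_of_real c) (at 0)"
proof -
  have "((\<lambda>x. exp (\<i> * complex_of_real c * x)) has_field_derivative \<i> * complex_of_real c) (at (complex_of_real 0))"
    by (auto intro!: derivative_eq_intros)
  then have "((\<lambda>s. exp (\<i> * complex_of_real c * complex_of_real s)) has_vector_derivative \<i> * complex_of_real c) (at 0)"
    by (rule has_vector_derivative_real_field)
  then show ?thesis by (simp add: cis_conv_exp mult.assoc)
qed

lemma has_dirderiv_character:
  assumes "\<And>z s. g (z + s *\<^sub>R v) = cis (c * s) * g z"
  shows "has_dirderiv v g (\<lambda>z. \<i> * complex_of_real c * g z)"
  unfolding has_dirderiv_def
proof
  fix z
  have "((\<lambda>s. cis (c * s) * g z) has_vector_derivative \<i> * complex_of_real c * g z) (at 0)"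
    by (rule has_vector_derivative_mult_left[OF has_vector_derivative_cis])
  then show "((\<lambda>s. g (z + s *\<^sub>R v)) has_vector_derivative \<i> * complex_of_real c * g z) (at 0)"
    by (simp add: assms)
qed

lemma iterpd_eigenfunction:
  assumes "\<And>k. has_dirderiv (e k) g (\<lambda>z. c k * g z)"
  shows "iterpd (concat (map (\<lambda>k. replicate (n k) (e k)) ks)) g = (\<lambda>z. (\<Prod>k\<leftarrow>ks. c k ^ n k) * g z)"
proof (induction ks)
  case (Cons k ks)
  have "iterpd (replicate m (e k)) (\<lambda>z. b * g z) = (\<lambda>z. c k ^ m * b * g z)" for m b
  proof (induction m)
    case (Suc m)
    then show ?case
      using dirderiv_eq[OF has_dirderiv_cmult[OF assms, of k "c k ^ m * b"]] by (simp add: mult_ac)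
  qed simp
  then show ?case using Cons by (simp add: iterpd_append)
qed simp

text \<open>Dual to \<open>iterpd_eigenfunction\<close>: the functional is the eigenvector.
  Derivatives are peeled off from the outside, which leaves a test function inside.\<close>

lemma functional_eigenfunction:
  fixes u :: "('a::euclidean_space \<Rightarrow> complex) \<Rightarrow> complex"
  assumes u: "\<And>k \<phi>. test_fun \<phi> \<Longrightarrow> u (dirderiv (e k) \<phi>) = c k * u \<phi>" and e: "\<And>k. e k \<in> Basis"
    and \<phi>: "test_fun \<phi>"
  shows "u (iterpd (concat (map (\<lambda>k. replicate (n k) (e k)) ks)) \<phi>) = (\<Prod>k\<leftarrow>ks. c k ^ n k) * u \<phi>"
proof (induction ks)
  case (Cons k ks)
  have "u (iterpd (replicate m (e k)) \<psi>) = c k ^ m * u \<psi>" if "test_fun \<psi>" for m \<psi>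
  proof (induction m)
    case (Suc m)
    have "test_fun (iterpd (replicate m (e k)) \<psi>)" using that e by (intro test_iterpd) auto
    then show ?case using Suc u by simp
  qed simp
  moreover have "test_fun (iterpd (concat (map (\<lambda>k. replicate (n k) (e k)) ks)) \<phi>)"
    using e by (intro test_iterpd \<phi>) auto
  ultimately show ?case using Cons by (simp add: iterpd_append)
qed simp

text \<open>This evaluates the linear extension of \<open>T^j |-> f j\<close> at \<open>q\<close>.
  Several keys of a polynomial in \<open>d + 1\<close> variables may share a time exponent and
  cancel, so a sum over keys has to be matched with the collected coefficients.\<close>

lemma sum_monom_functional:
  fixes C :: "'i \<Rightarrow> 'b::comm_ring_1" and n :: "'i \<Rightarrow> nat"
  assumes "finite I"
  defines "q \<equiv> \<Sum>\<alpha>\<in>I. monom (C \<alpha>) (n \<alpha>)"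
  shows "(\<Sum>j\<le>degree q. coeff q j * f j) = (\<Sum>\<alpha>\<in>I. C \<alpha> * f (n \<alpha>))"
proof -
  \<comment> \<open>A common bound: after cancellation \<open>degree q\<close> may lie below some of
    the exponents.\<close>
  define M where "M = degree q + (\<Sum>\<alpha>\<in>I. n \<alpha>)"
  have n: "n \<alpha> \<le> M" if "\<alpha> \<in> I" for \<alpha>
    using member_le_sum[of \<alpha> I n] that assms(1) by (simp add: M_def)
  have "(\<Sum>j\<le>degree q. coeff q j * f j) = (\<Sum>j\<le>M. coeff q j * f j)"
    by (rule sum.mono_neutral_left) (auto simp: M_def coeff_eq_0)
  also have "\<dots> = (\<Sum>j\<le>M. \<Sum>\<alpha>\<in>I. (if n \<alpha> = j then C \<alpha> * f j else 0))"
    unfolding q_def by (auto simp: coeff_sum sum_distrib_right intro!: sum.cong)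
  also have "\<dots> = (\<Sum>\<alpha>\<in>I. \<Sum>j\<le>M. (if n \<alpha> = j then C \<alpha> * f j else 0))"
    by (rule sum.swap)
  also have "\<dots> = (\<Sum>\<alpha>\<in>I. C \<alpha> * f (n \<alpha>))"
    using n by (intro sum.cong) (auto simp: sum.delta')
  finally show ?thesis .
qed

section \<open>Mixed derivatives of the operator\<close>

lemma time_direction_in_Basis: "(0, 1) \<in> (Basis :: ((real^'n) \<times> real) set)"
  by (simp add: Basis_prod_def)

lemma space_direction_in_Basis: "(axis k 1, 0) \<in> (Basis :: ((real^'n) \<times> real) set)"
  by (simp add: Basis_prod_def axis_in_Basis_iff)

text \<open>Replaces the \<open>SOME\<close> in \<open>pderiv_xt\<close> by one fixed enumeration of
  the coordinates and separates time from space derivatives.\<close>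

lemma pderiv_xt_conv:
  obtains ks :: "'n::finite list" where "distinct ks" "set ks = UNIV"
    "\<And>\<alpha> f. pderiv_xt \<alpha> f = iterpd (replicate (snd \<alpha>) (0, 1)) (iterpd (concat (map (\<lambda>k. replicate (fst \<alpha> k) (axis k 1, 0)) ks)) f)"
proof -
  define ks where "ks = (SOME xs. distinct xs \<and> set xs = (UNIV :: 'n set))"
  have "distinct ks \<and> set ks = UNIV"
    unfolding ks_def by (rule someI_ex) (metis finite finite_distinct_list)
  then show ?thesis using that[of ks] by (simp add: pderiv_xt_def ks_def iterpd_append)
qed

lemma pderiv_xt_iterpd:
  fixes \<alpha> :: "('n::finite \<Rightarrow> nat) \<times> nat"
  obtains vs where "set vs \<subseteq> Basis" "\<And>f. pderiv_xt \<alpha> f = iterpd vs f"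
proof -
  obtain ks :: "'n list" where "distinct ks" "set ks = UNIV" and ks: "\<And>\<alpha> f. pderiv_xt \<alpha> f = iterpd (replicate (snd \<alpha>) (0, 1)) (iterpd (concat (map (\<lambda>k. replicate (fst \<alpha> k) (axis k 1, 0)) ks)) f)"
    by (rule pderiv_xt_conv) blast
  show ?thesis
    by (rule that[of "replicate (snd \<alpha>) (0, 1) @ concat (map (\<lambda>k. replicate (fst \<alpha> k) (axis k 1, 0)) ks)"])
      (auto simp: ks iterpd_append time_direction_in_Basis space_direction_in_Basis)
qed

lemma pderiv_xt_eigenfunction:
  fixes g :: "(real^'n::finite) \<times> real \<Rightarrow> complex"
  assumes g: "smooth_fun g" and c: "\<And>k. has_dirderiv (axis k 1, 0) g (\<lambda>z. c k * g z)"
  shows "pderiv_xt \<alpha> g = (\<lambda>z. (\<Prod>k\<in>UNIV. c k ^ fst \<alpha> k) * iterpd (replicate (snd \<alpha>) (0, 1)) g z)"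
proof -
  obtain ks :: "'n list" where ks: "distinct ks" "set ks = UNIV"
    "\<And>\<alpha> f. pderiv_xt \<alpha> f = iterpd (replicate (snd \<alpha>) (0, 1)) (iterpd (concat (map (\<lambda>k. replicate (fst \<alpha> k) (axis k 1, 0)) ks)) f)"
    by (rule pderiv_xt_conv) blast
  have "(\<Prod>k\<leftarrow>ks. c k ^ fst \<alpha> k) = (\<Prod>k\<in>UNIV. c k ^ fst \<alpha> k)"
    using ks by (metis prod.distinct_set_conv_list)
  then show ?thesis
    unfolding ks(3) iterpd_eigenfunction[of "\<lambda>k. (axis k 1, 0)", OF c]
    using time_direction_in_Basis by (subst iterpd_cmult[OF g]) auto
qed

text \<open>Symmetry of mixed derivatives moves the space derivatives outermost, where the
  eigenvalue equation of \<open>u\<close> can strip them.\<close>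

lemma pderiv_xt_functional:
  fixes u :: "'n::finite dist_xt"
  assumes u: "\<And>k \<phi>. test_fun \<phi> \<Longrightarrow> u (dirderiv (axis k 1, 0) \<phi>) = c k * u \<phi>" and \<phi>: "test_fun \<phi>"
  shows "u (pderiv_xt \<alpha> \<phi>) = (\<Prod>k\<in>UNIV. c k ^ fst \<alpha> k) * u (iterpd (replicate (snd \<alpha>) (0, 1)) \<phi>)"
proof -
  obtain ks :: "'n list" where ks: "distinct ks" "set ks = UNIV"
    "\<And>\<alpha> f. pderiv_xt \<alpha> f = iterpd (replicate (snd \<alpha>) (0, 1)) (iterpd (concat (map (\<lambda>k. replicate (fst \<alpha> k) (axis k 1, 0)) ks)) f)"
    by (rule pderiv_xt_conv) blast
  let ?X = "concat (map (\<lambda>k. replicate (fst \<alpha> k) (axis k 1, 0)) ks) :: ((real^'n) \<times> real) list"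
  let ?T = "replicate (snd \<alpha>) (0, 1) :: ((real^'n) \<times> real) list"
  have B: "set ?X \<subseteq> Basis" "set ?T \<subseteq> Basis"
    using time_direction_in_Basis space_direction_in_Basis by auto
  have "pderiv_xt \<alpha> \<phi> = iterpd ?X (iterpd ?T \<phi>)"
    unfolding ks(3) using iterpd_swap[OF test_smooth[OF \<phi>] B] by simp
  moreover have "u (iterpd ?X (iterpd ?T \<phi>)) = (\<Prod>k\<leftarrow>ks. c k ^ fst \<alpha> k) * u (iterpd ?T \<phi>)"
    by (rule functional_eigenfunction[of u "\<lambda>k. (axis k 1, 0)", OF u space_direction_in_Basis test_iterpd[OF \<phi> B(2)]])
  moreover have "(\<Prod>k\<leftarrow>ks. c k ^ fst \<alpha> k) = (\<Prod>k\<in>UNIV. c k ^ fst \<alpha> k)"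
    using ks by (metis prod.distinct_set_conv_list)
  ultimately show ?thesis by simp
qed

text \<open>Space derivatives act on \<open>g\<close> as multiplication by
  \<open>\<i> * v $ k\<close>, so along the time line over a fixed point of space the equation is an
  ODE.\<close>

lemma character_pde_zero:
  fixes g :: "(real^'n::finite) \<times> real \<Rightarrow> complex" and p :: "'n cpoly"
  assumes g: "smooth_fun g"
    and char: "\<And>x z. g (z + (x, 0)) = cis (v \<bullet> x) * g z"
    and pde: "\<And>z. (\<Sum>\<alpha>\<in>Poly_Mapping.keys p. Poly_Mapping.lookup p \<alpha> * (-1) ^ (sum (fst \<alpha>) UNIV + snd \<alpha>) * pderiv_xt \<alpha> g z) = 0"
    and zero: "\<And>z. snd z > S \<Longrightarrow> g z = 0"
    and nz: "\<exists>t. peval p (\<chi> k. \<i> * complex_of_real (- v $ k)) t \<noteq> 0"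
  shows "g = (\<lambda>_. 0)"
proof
  fix z :: "(real^'n) \<times> real"
  define y where "y = fst z"
  define \<gamma> where "\<gamma> j s = iterpd (replicate j (0, 1)) g (y, s)" for j s
  \<comment> \<open>All signs are absorbed here, so that \<open>q(T) = p(-iv, -T)\<close>; thus
    \<open>q\<close> is nonzero once \<open>p(-iv, .)\<close> is not identically 0.\<close>
  define C where "C \<alpha> = Poly_Mapping.lookup p \<alpha> * (\<Prod>k\<in>UNIV. (\<i> * complex_of_real (- v $ k)) ^ fst \<alpha> k) * (-1) ^ snd \<alpha>" for \<alpha>
  define q where "q = (\<Sum>\<alpha>\<in>Poly_Mapping.keys p. monom (C \<alpha>) (snd \<alpha>))"
  have T: "set (replicate j (0, 1)) \<subseteq> (Basis :: ((real^'n) \<times> real) set)" for j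
    using time_direction_in_Basis by auto
  have deriv: "(\<gamma> j has_vector_derivative \<gamma> (Suc j) s) (at s)" for j s
    using has_dirderiv_at[OF smooth_has_dirderiv[OF smooth_iterpd[OF g T] time_direction_in_Basis], of j "(y, 0)" s UNIV]
    by (simp add: \<gamma>_def[abs_def])
  have \<gamma>0: "\<gamma> j s = 0" if "s > S" for j s
  proof -
    have "open {z :: (real^'n) \<times> real. snd z > S}" by (intro open_Collect_less continuous_intros)
    then show ?thesis unfolding \<gamma>_def by (rule iterpd_eq_0) (use zero that in auto)
  qed
  have "has_dirderiv (axis k 1, 0) g (\<lambda>z. \<i> * complex_of_real (v $ k) * g z)" for k
  proof (rule has_dirderiv_character)
    show "g (z + s *\<^sub>R (axis k 1, 0)) = cis (v $ k * s) * g z" for z s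
      using char[of z "s *\<^sub>R axis k 1"] by (simp add: inner_axis mult.commute)
  qed
  note pd = pderiv_xt_eigenfunction[OF g this]
  have "(\<Sum>j\<le>degree q. coeff q j * \<gamma> j s) = 0" for s
  proof -
    have "(\<Sum>\<alpha>\<in>Poly_Mapping.keys p. C \<alpha> * \<gamma> (snd \<alpha>) s) = 0"
    proof -
      have "(\<Prod>k\<in>UNIV. (\<i> * complex_of_real (- v $ k)) ^ fst \<alpha> k) = (-1) ^ sum (fst \<alpha>) UNIV * (\<Prod>k\<in>UNIV. (\<i> * complex_of_real (v $ k)) ^ fst \<alpha> k)" for \<alpha> :: "('n \<Rightarrow> nat) \<times> nat"
        by (simp add: power_sum power_minus[of "\<i> * _"] prod.distrib)
      then show ?thesis
        using pde[of "(y, s)"] by (simp add: pd C_def \<gamma>_def power_add mult_ac)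
    qed
    then show ?thesis unfolding q_def by (subst sum_monom_functional) auto
  qed
  moreover have "q \<noteq> 0"
  proof
    assume "q = 0"
    obtain t where t: "peval p (\<chi> k. \<i> * complex_of_real (- v $ k)) t \<noteq> 0" using nz by blast
    have "poly q (- t) = peval p (\<chi> k. \<i> * complex_of_real (- v $ k)) t"
      unfolding q_def peval_def poly_sum poly_monom C_def
      by (intro sum.cong refl) (simp add: mult.assoc flip: power_mult_distrib)
    then show False using t \<open>q = 0\<close> by simp
  qed
  ultimately have "\<gamma> 0 (snd z) = 0"
    using ode_zero[of \<gamma> S q] deriv \<gamma>0 by blast
  then show "g z = 0" by (simp add: \<gamma>_def y_def)
qed

section \<open>The lattice of frequencies\<close>

lemma span_range_UNIV:
  fixes a :: "'n::finite \<Rightarrow> real^'n"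
  assumes "inj a" "independent (range a)"
  shows "span (range a) = UNIV"
proof -
  have "UNIV \<subseteq> span (range a)"
    by (rule card_ge_dim_independent) (use assms in \<open>auto simp: card_image\<close>)
  then show ?thesis by auto
qed

text \<open>Row \<open>k\<close> of the identity \<open>A v = y\<close>, once \<open>A\<close> is
  known to be invertible.\<close>

lemma inner_matrix_inv:
  fixes a :: "'n::finite \<Rightarrow> real^'n"
  assumes "inj a" "independent (range a)"
  shows "a k \<bullet> (matrix_inv (\<chi> k. a k) *v y) = y $ k"
proof -
  define A where "A = (\<chi> k. a k)"
  have A: "(A *v x) $ k = a k \<bullet> x" for x k
    by (simp add: A_def matrix_vector_mult_def inner_vec_def)
  \<comment> \<open>The difference of two points with equal image is orthogonal to all rows, hence
    to their span, hence to itself.\<close>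
  have "inj ((*v) A)"
  proof (rule injI)
    fix x x' assume "A *v x = A *v x'"
    then have "a k \<bullet> (x - x') = 0" for k using A by (metis inner_diff_right eq_iff_diff_eq_0)
    then have "(x - x') \<bullet> w = 0" if "w \<in> range a" for w using that by (auto simp: inner_commute)
    moreover have "(x - x') \<bullet> w = 0" if "\<And>w. w \<in> range a \<Longrightarrow> (x - x') \<bullet> w = 0" "w \<in> span (range a)" for w
      using that(2)
    proof (induction rule: span_induct_alt)
      case (step c w y) then show ?case using that(1) by (simp add: inner_add_right)
    qed simp
    ultimately have "(x - x') \<bullet> (x - x') = 0" using span_range_UNIV[OF assms] by blast
    then show "x = x'" by simp
  qed
  then have "invertible A"
    unfolding invertible_left_inverse matrix_left_invertible_injective by (simp add: inj_def)
  then have "A ** matrix_inv A = mat 1"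
    unfolding invertible_def matrix_inv_def by (metis (mono_tags, lifting) someI_ex)
  then have "A *v (matrix_inv A *v y) = y" by (simp add: matrix_vector_mul_assoc)
  then show ?thesis using A by (metis A_def)
qed

text \<open>Phases add up along linear combinations of the \<open>a k\<close>. This carries the
  character property to the coordinate directions, in which the derivatives are taken.\<close>

lemma character_from_basis:
  fixes a :: "'n::finite \<Rightarrow> real^'n" and g :: "(real^'n) \<times> real \<Rightarrow> complex"
  assumes a: "inj a" "independent (range a)"
    and char: "\<And>k z c. g (z + c *\<^sub>R (a k, 0)) = cis (c * (v \<bullet> a k)) * g z"
  shows "g (z + (x, 0)) = cis (v \<bullet> x) * g z"
proof -
  have "x \<in> span (range a)" using span_range_UNIV[OF a] by simp
  then show ?thesis
  proof (induction arbitrary: z rule: span_induct_alt)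
    case (step c w x)
    then obtain k where k: "w = a k" by blast
    have eq: "z + (c *\<^sub>R w + x, 0) = (z + (x, 0)) + c *\<^sub>R (a k, 0)" by (simp add: k prod_eq_iff)
    have "g (z + (c *\<^sub>R w + x, 0)) = cis (c * (v \<bullet> a k)) * (cis (v \<bullet> x) * g z)"
      unfolding eq char step(2) ..
    also have "\<dots> = cis (v \<bullet> (c *\<^sub>R w + x)) * g z"
      by (simp add: k cis_mult inner_add_right flip: mult.assoc)
    finally show ?case .
  qed (simp add: zero_prod_def[symmetric])
qed

lemma kernel_trivial:
  fixes a :: "'n::finite \<Rightarrow> real^'n" and p :: "'n cpoly"
  assumes a: "inj a" "independent (range a)"
    and nz: "\<And>m :: real^'n. (\<And>k. m $ k \<in> \<int>) \<Longrightarrow>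
      \<exists>t. peval p (\<chi> k. \<i> * complex_of_real ((matrix_inv (\<chi> k. a k) *v ((2 * pi) *\<^sub>R m)) $ k)) t \<noteq> 0"
    and u: "u \<in> N_S a p"
  shows "u = (\<lambda>_. 0)"
proof -
  have dist: "distribution u" and
    per: "\<And>\<psi> \<phi> k. test_fun \<psi> \<Longrightarrow> test_fun \<phi> \<Longrightarrow> u (\<lambda>(x, t). \<psi> (x + a k) * \<phi> t) = u (\<lambda>(x, t). \<psi> x * \<phi> t)"
    and Dp: "Dp p u = (\<lambda>_. 0)" and van: "vanishes_neg_time u"
    using u by (auto simp: N_S_def periodic_dist_def)
  have tensor: "u (\<lambda>(x, t). \<psi> x * \<phi> t) = 0" if \<psi>: "test_fun \<psi>" and \<phi>: "test_fun \<phi>" for \<psi> :: "real^'n \<Rightarrow> complex" and \<phi> :: "real \<Rightarrow> complex"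
  proof -
    \<comment> \<open>A tensor product remains one under translation, so periodicity of
      \<open>u\<close> applies to every translate of \<open>f\<close>.\<close>
    define f where "f = (\<lambda>(x, t). \<psi> x * \<phi> t)"
    have f: "test_fun f" unfolding f_def by (rule test_tensor[OF \<psi> \<phi>])
    obtain R where R: "\<And>z. norm z > R \<Longrightarrow> f z = 0" using f unfolding test_fun_iff by blast
    define Q where "Q g \<longleftrightarrow> smooth_fun g \<and>
      (\<forall>z. (\<Sum>\<alpha>\<in>Poly_Mapping.keys p. Poly_Mapping.lookup p \<alpha> * (-1) ^ (sum (fst \<alpha>) UNIV + snd \<alpha>) * pderiv_xt \<alpha> g z) = 0) \<and>
      (\<forall>z k. g (z + (a k, 0)) = g z) \<and> (\<forall>z. snd z > R + 1 \<longrightarrow> g z = 0)" for g :: "(real^'n) \<times> real \<Rightarrow> complex"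
    \<comment> \<open>Scaled so that the period \<open>a k\<close> corresponds to the angle
      \<open>2 pi\<close>.\<close>
    define w where "w k = (1 / (2 * pi)) *\<^sub>R (a k, 0::real)" for k
    have w: "(2 * pi) *\<^sub>R w k = (a k, 0)" for k by (simp add: w_def)
    have "Q (regularize u f)"
      unfolding Q_def
    proof (intro conjI allI impI)
      show "smooth_fun (regularize u f)" by (rule smooth_regularize[OF dist f])
    next
      fix z
      have "u (pderiv_xt \<alpha> (\<lambda>w. f (w + z))) = pderiv_xt \<alpha> (regularize u f) z" for \<alpha>
      proof -
        obtain vs where vs: "set vs \<subseteq> Basis" "\<And>f. pderiv_xt \<alpha> f = iterpd vs f" by (rule pderiv_xt_iterpd[of \<alpha>]) blast
        show ?thesis
          unfolding vs(2) iterpd_regularize[OF dist f vs(1)] iterpd_translate[OF test_smooth[OF f] vs(1)]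
          by (simp add: regularize_def)
      qed
      then show "(\<Sum>\<alpha>\<in>Poly_Mapping.keys p. Poly_Mapping.lookup p \<alpha> * (-1) ^ (sum (fst \<alpha>) UNIV + snd \<alpha>) * pderiv_xt \<alpha> (regularize u f) z) = 0"
        using fun_cong[OF Dp, of "\<lambda>w. f (w + z)"] test_translate[OF f, of z] by (simp add: Dp_def)
    next
      fix z k
      have "u (\<lambda>(x, t). \<psi> ((x + a k) + fst z) * \<phi> (t + snd z)) = u (\<lambda>(x, t). \<psi> (x + fst z) * \<phi> (t + snd z))"
        by (rule per[OF test_translate[OF \<psi>] test_translate[OF \<phi>]])
      then show "regularize u f (z + (a k, 0)) = regularize u f z"
        by (simp add: regularize_def f_def case_prod_unfold add_ac)
    next
      fix z :: "(real^'n) \<times> real" assume z: "snd z > R + 1"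
      \<comment> \<open>The shifted \<open>f\<close> lives at times at most -1; this margin keeps
        the closure of its support in the open half-space.\<close>
      have "closure {y. f (y + z) \<noteq> 0} \<subseteq> {y. snd y \<le> -1}"
      proof (rule closure_minimal)
        show "closed {y :: (real^'n) \<times> real. snd y \<le> -1}" by (intro closed_Collect_le continuous_intros)
        show "{y. f (y + z) \<noteq> 0} \<subseteq> {y. snd y \<le> -1}"
        proof safe
          fix x t assume "f ((x, t) + z) \<noteq> 0"
          then have "norm ((x, t) + z) \<le> R" using R[of "(x, t) + z"] by (meson not_le)
          moreover have "norm (snd ((x, t) + z)) \<le> norm ((x, t) + z)" by (metis norm_snd_le prod.collapse)
          ultimately show "snd (x, t) \<le> -1" using z by simp
        qed
      qed
      then have "closure {y. f (y + z) \<noteq> 0} \<subseteq> {(x, t). t < 0}" by (fastforce simp: case_prod_unfold)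
      then show "regularize u f z = 0"
        using van test_translate[OF f, of z] unfolding vanishes_neg_time_def regularize_def by blast
    qed
    moreover have "g = (\<lambda>_. 0)" if "Q g" for g
    proof (rule fourier_reduction[of Q w, OF _ _ _ _ that])
      show "continuous_on UNIV g" if "Q g" for g using that smooth_continuous by (auto simp: Q_def)
      show "g (z + (2 * pi) *\<^sub>R w k) = g z" if "Q g" for g k z
        using that unfolding Q_def w by blast
    next
      fix g k and m :: int assume Qg: "Q g"
      then have g: "smooth_fun g"
        and pde: "\<And>z. (\<Sum>\<alpha>\<in>Poly_Mapping.keys p. Poly_Mapping.lookup p \<alpha> * (-1) ^ (sum (fst \<alpha>) UNIV + snd \<alpha>) * pderiv_xt \<alpha> g z) = 0"
        and g_per: "\<And>z j. g (z + (a j, 0)) = 1 * g z" and g_zero: "\<And>z. snd z > R + 1 \<Longrightarrow> g z = 0"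
        unfolding Q_def by auto
      show "Q (fourier_average (w k) m g)"
        unfolding Q_def
      proof (intro conjI allI impI)
        show "smooth_fun (fourier_average (w k) m g)" by (rule smooth_fourier_average[OF g])
      next
        fix z
        let ?c = "\<lambda>\<alpha>. Poly_Mapping.lookup p \<alpha> * (-1) ^ (sum (fst \<alpha>) UNIV + snd \<alpha>)"
        let ?h = "\<lambda>\<alpha> \<theta>. cis (- (of_int m * \<theta>)) * pderiv_xt \<alpha> g (z + \<theta> *\<^sub>R w k)"
        have 1: "pderiv_xt \<alpha> (fourier_average (w k) m g) z = integral {-pi..pi} (?h \<alpha>)"
          and 2: "?h \<alpha> integrable_on {-pi..pi}" for \<alpha>
        proof -
          obtain vs where vs: "set vs \<subseteq> Basis" "\<And>f. pderiv_xt \<alpha> f = iterpd vs f" by (rule pderiv_xt_iterpd[of \<alpha>]) blast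
          show "pderiv_xt \<alpha> (fourier_average (w k) m g) z = integral {-pi..pi} (?h \<alpha>)"
            unfolding vs(2) iterpd_fourier_average[OF g vs(1)] by (simp add: fourier_average_def)
          show "?h \<alpha> integrable_on {-pi..pi}"
            unfolding vs(2) cis_conv_exp
            by (intro integrable_continuous_real continuous_intros smooth_continuous_compose[OF smooth_iterpd[OF g vs(1)]])
        qed
        \<comment> \<open>Constant coefficients let the operator commute with the average over
          translates; under the integral the equation for \<open>g\<close> appears at shifted
          points.\<close>
        have "(\<Sum>\<alpha>\<in>Poly_Mapping.keys p. ?c \<alpha> * integral {-pi..pi} (?h \<alpha>)) = integral {-pi..pi} (\<lambda>\<theta>. \<Sum>\<alpha>\<in>Poly_Mapping.keys p. ?c \<alpha> * ?h \<alpha> \<theta>)"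
          using 2 by (subst Henstock_Kurzweil_Integration.integral_sum) (auto intro!: integrable_on_mult_right)
        also have "\<dots> = integral {-pi..pi} (\<lambda>\<theta>. cis (- (of_int m * \<theta>)) * (\<Sum>\<alpha>\<in>Poly_Mapping.keys p. ?c \<alpha> * pderiv_xt \<alpha> g (z + \<theta> *\<^sub>R w k)))"
          by (simp add: sum_distrib_left mult_ac)
        also have "\<dots> = 0" unfolding pde by simp
        finally show "(\<Sum>\<alpha>\<in>Poly_Mapping.keys p. ?c \<alpha> * pderiv_xt \<alpha> (fourier_average (w k) m g) z) = 0"
          unfolding 1 .
      next
        fix z j
        show "fourier_average (w k) m g (z + (a j, 0)) = fourier_average (w k) m g z"
          using fourier_average_translate[of g "(a j, 0)" 1, OF g_per] by simp
      next
        fix z :: "(real^'n) \<times> real" assume "snd z > R + 1"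
        then show "fourier_average (w k) m g z = 0"
          using g_zero by (simp add: fourier_average_def w_def)
      qed
    next
      fix g and m :: "'n \<Rightarrow> int" assume Qg: "Q g" and char: "\<And>k z c. g (z + c *\<^sub>R w k) = cis (of_int (m k) * c) * g z"
      \<comment> \<open>The operator acting on \<open>g\<close> is \<open>p(-\<partial>)\<close>, so \<open>p(iv, \<cdot>)\<close> is met at the frequency \<open>-v\<close> of \<open>g\<close>.\<close>
      define m' :: "real^'n" where "m' = (\<chi> k. - of_int (m k))"
      define v where "v = - (matrix_inv (\<chi> k. a k) *v ((2 * pi) *\<^sub>R m'))"
      have va: "v \<bullet> a k = 2 * pi * of_int (m k)" for k
        using inner_matrix_inv[OF a, of k "(2 * pi) *\<^sub>R m'"] by (simp add: v_def m'_def inner_commute)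
      have char': "g (z + c *\<^sub>R (a k, 0)) = cis (c * (v \<bullet> a k)) * g z" for k z c
        using char[of z "2 * pi * c" k] by (simp add: w_def va mult_ac)
      have "\<exists>t. peval p (\<chi> k. \<i> * complex_of_real (- v $ k)) t \<noteq> 0"
        using nz[of m'] by (simp add: m'_def v_def)
      then show "g = (\<lambda>_. 0)"
        using Qg by (intro character_pde_zero[of g v p "R + 1"] character_from_basis[OF a char']) (auto simp: Q_def)
    qed
    ultimately have "regularize u f = (\<lambda>_. 0)" by blast
    then have "regularize u f 0 = 0" by simp
    then show ?thesis by (simp add: regularize_def f_def)
  qed
  have "u f = 0" for f
  proof (cases "test_fun f")
    case True then show ?thesis using tensor_density[OF dist tensor] by blast
  next
    case False then show ?thesis using dist by (simp add: distribution_def)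
  qed
  then show ?thesis by blast
qed

section \<open>Nontrivial elements of the kernel\<close>

lemma integrable_compact_support:
  fixes h :: "'a::euclidean_space \<Rightarrow> 'b::euclidean_space"
  assumes "continuous_on UNIV h" and "\<And>x. norm x > R \<Longrightarrow> h x = 0"
  shows "integrable lborel h"
proof -
  have "integrable lborel (\<lambda>x. indicat_real (cball 0 R) x *\<^sub>R h x)"
    by (intro borel_integrable_compact continuous_on_subset[OF assms(1)]) auto
  moreover have "(\<lambda>x. indicat_real (cball 0 R) x *\<^sub>R h x) = h"
    using assms(2) by (auto simp: fun_eq_iff indicator_def)
  ultimately show ?thesis by simp
qed

lemma lborel_integral_translate:
  fixes h :: "'a::euclidean_space \<Rightarrow> 'b::euclidean_space"
  assumes "continuous_on UNIV h"
  shows "(\<integral>x. h (x + c) \<partial>lborel) = (\<integral>x. h x \<partial>lborel)"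
proof -
  have "h \<in> borel_measurable borel" using assms by (rule borel_measurable_continuous_onI)
  then have "(\<integral>x. h x \<partial>distr lborel borel ((+) c)) = (\<integral>x. h (c + x) \<partial>lborel)"
    by (intro integral_distr) auto
  then show ?thesis by (simp add: lborel_distr_plus add.commute)
qed

definition character_delta :: "real^'n \<Rightarrow> 'n::finite dist_xt" where
  "character_delta v \<phi> = (if test_fun \<phi> then \<integral>x. cis (v \<bullet> x) * \<phi> (x, 0) \<partial>lborel else 0)"

lemma character_slice:
  assumes "test_fun (\<phi> :: (real^'n::finite) \<times> real \<Rightarrow> complex)"
  shows "continuous_on UNIV (\<lambda>x. cis (v \<bullet> x) * \<phi> (x, 0))"
    and "integrable lborel (\<lambda>x. cis (v \<bullet> x) * \<phi> (x, 0))"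
proof -
  show c: "continuous_on UNIV (\<lambda>x. cis (v \<bullet> x) * \<phi> (x, 0))"
    unfolding cis_conv_exp
    by (intro continuous_intros smooth_continuous_compose[OF test_smooth[OF assms]])
  obtain R where R: "\<And>z. norm z > R \<Longrightarrow> \<phi> z = 0" using assms unfolding test_fun_iff by blast
  show "integrable lborel (\<lambda>x. cis (v \<bullet> x) * \<phi> (x, 0))"
    by (rule integrable_compact_support[OF c, of R]) (simp add: R)
qed

lemma character_delta_distribution:
  fixes v :: "real^'n::finite"
  shows "distribution (character_delta v)"
  unfolding distribution_def
proof (intro conjI allI impI)
  fix f g :: "(real^'n) \<times> real \<Rightarrow> complex" assume "test_fun f" "test_fun g"
  then show "character_delta v (\<lambda>x. f x + g x) = character_delta v f + character_delta v g"
    by (simp add: character_delta_def test_add distrib_left character_slice(2))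
next
  fix c and f :: "(real^'n) \<times> real \<Rightarrow> complex" assume "test_fun f"
  then show "character_delta v (\<lambda>x. c * f x) = c * character_delta v f"
    by (simp add: character_delta_def test_cmult mult.left_commute[of _ c])
next
  fix \<phi> :: "nat \<Rightarrow> (real^'n) \<times> real \<Rightarrow> complex" assume conv: "D_conv0 \<phi>"
  then have test: "\<And>k. test_fun (\<phi> k)" by (simp add: D_conv0_def)
  obtain K where K: "compact K" "\<And>k z. z \<notin> K \<Longrightarrow> \<phi> k z = 0" using conv unfolding D_conv0_def by blast
  obtain R where R: "\<And>z. z \<in> K \<Longrightarrow> norm z \<le> R" using compact_imp_bounded[OF K(1)] unfolding bounded_iff by blast
  have \<phi>0: "\<phi> k (x, 0) = 0" if "x \<notin> cball 0 R" for k x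
  proof (rule K(2))
    show "(x, 0) \<notin> K" using R[of "(x, 0)"] that by auto
  qed
  define C where "C = measure lborel (cball (0 :: real^'n) R)"
  have ind: "integrable lborel (\<lambda>x :: real^'n. indicat_real (cball 0 R) x * e)" for e
    using borel_integrable_compact[of "cball (0 :: real^'n) R" "\<lambda>_. e"] by simp
  show "(\<lambda>k. character_delta v (\<phi> k)) \<longlonglongrightarrow> 0"
  proof (rule tendstoI)
    fix e :: real assume e: "e > 0"
    \<comment> \<open>The functional is bounded by \<open>C\<close> times the supremum norm,
      \<open>C\<close> being the volume of a ball that catches all supports; hence the empty list of
      derivatives is enough below.\<close>
    define d where "d = e / (C + 1)"
    have C: "C \<ge> 0" by (simp add: C_def)
    then have d: "d > 0" "C * d < e" using e by (auto simp: d_def field_simps)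
    have "uniform_limit UNIV (\<lambda>k. iterpd [] (\<phi> k)) (\<lambda>_. 0) sequentially"
      using conv unfolding D_conv0_def by (metis empty_subsetI list.set(1))
    then have "\<forall>\<^sub>F k in sequentially. \<forall>z\<in>UNIV. dist (iterpd [] (\<phi> k) z) 0 < d"
      using d(1) by (rule uniform_limitD)
    then show "\<forall>\<^sub>F k in sequentially. dist (character_delta v (\<phi> k)) 0 < e"
    proof (rule eventually_mono)
      fix k assume lt: "\<forall>z\<in>UNIV. dist (iterpd [] (\<phi> k) z) 0 < d"
      have small: "norm (\<phi> k z) \<le> d" for z using bspec[OF lt, of z] by simp
      have "norm (character_delta v (\<phi> k)) \<le> (\<integral>x. norm (cis (v \<bullet> x) * \<phi> k (x, 0)) \<partial>lborel)"
        using test by (simp add: character_delta_def)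
      also have "\<dots> \<le> (\<integral>x. indicat_real (cball (0 :: real^'n) R) x * d \<partial>lborel)"
      proof (rule Bochner_Integration.integral_mono)
        show "integrable lborel (\<lambda>x :: real^'n. indicat_real (cball 0 R) x * d)" by (rule ind)
        show "integrable lborel (\<lambda>x. norm (cis (v \<bullet> x) * \<phi> k (x, 0)))"
          using character_slice(2)[OF test] by (rule integrable_norm)
        show "norm (cis (v \<bullet> x) * \<phi> k (x, 0)) \<le> indicat_real (cball 0 R) x * d" for x
          using small[of "(x, 0)"] \<phi>0[of x k] by (cases "x \<in> cball 0 R") (auto simp: norm_mult)
      qed
      also have "\<dots> = C * d" by (simp add: C_def)
      finally show "dist (character_delta v (\<phi> k)) 0 < e" using d(2) by simp
    qed
  qed
qed (simp add: character_delta_def)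

lemma character_delta_translate:
  assumes \<phi>: "test_fun \<phi>"
  shows "character_delta v (\<lambda>z. \<phi> (z + (y, 0))) = cis (- (v \<bullet> y)) * character_delta v \<phi>"
proof -
  have shift: "(\<integral>x. cis (v \<bullet> (x + y)) * \<phi> (x + y, 0) \<partial>lborel) = character_delta v \<phi>"
    using lborel_integral_translate[OF character_slice(1)[OF \<phi>, of v], of y] \<phi> by (simp add: character_delta_def)
  have cis: "cis (v \<bullet> x) = cis (- (v \<bullet> y)) * cis (v \<bullet> (x + y))" for x
    by (simp add: cis_mult inner_add_right)
  have "character_delta v (\<lambda>z. \<phi> (z + (y, 0))) = (\<integral>x. cis (v \<bullet> x) * \<phi> (x + y, 0) \<partial>lborel)"
    using test_translate[OF \<phi>] by (simp add: character_delta_def)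
  also have "\<dots> = (\<integral>x. cis (- (v \<bullet> y)) * (cis (v \<bullet> (x + y)) * \<phi> (x + y, 0)) \<partial>lborel)"
    by (subst cis) (simp only: mult.assoc)
  also have "\<dots> = cis (- (v \<bullet> y)) * character_delta v \<phi>"
    by (simp only: integral_mult_right_zero shift)
  finally show ?thesis .
qed

text \<open>In place of an integration by parts: translation shows that the regularisation is a
  character in space, so its derivative is known in two ways, which are compared at the
  origin.\<close>

lemma character_delta_dirderiv:
  fixes v :: "real^'n::finite"
  assumes \<phi>: "test_fun \<phi>"
  shows "character_delta v (dirderiv (axis k 1, 0) \<phi>) = - (\<i> * complex_of_real (v $ k)) * character_delta v \<phi>"
proof -
  let ?e = "(axis k 1, 0) :: (real^'n) \<times> real"
  let ?G = "regularize (character_delta v) \<phi>"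
  have "has_dirderiv ?e ?G (regularize (character_delta v) (dirderiv ?e \<phi>))"
    by (rule regularize_has_dirderiv[OF character_delta_distribution \<phi> space_direction_in_Basis])
  moreover have "has_dirderiv ?e ?G (\<lambda>z. \<i> * complex_of_real (- v $ k) * ?G z)"
  proof (rule has_dirderiv_character)
    fix z s
    have "character_delta v (\<lambda>w. \<phi> (w + (s *\<^sub>R axis k 1, 0) + z)) = cis (- (v \<bullet> s *\<^sub>R axis k 1)) * character_delta v (\<lambda>w. \<phi> (w + z))"
      by (rule character_delta_translate[OF test_translate[OF \<phi>, of z]])
    then show "?G (z + s *\<^sub>R ?e) = cis (- v $ k * s) * ?G z"
      by (simp add: regularize_def inner_axis add_ac mult.commute)
  qed
  ultimately have "regularize (character_delta v) (dirderiv ?e \<phi>) = (\<lambda>z. \<i> * complex_of_real (- v $ k) * ?G z)"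
    using dirderiv_eq by metis
  from fun_cong[OF this, of 0] show ?thesis by (simp add: regularize_def)
qed

text \<open>The signs from the distributional space derivatives cancel those of the eigenvalues.
  What remains is the functional \<open>T^j |-> U j\<close> at the polynomial
  \<open>p(iv, T)\<close>, which is 0 because all its values are.\<close>

lemma character_delta_Dp:
  fixes v :: "real^'n::finite" and p :: "'n cpoly"
  assumes "\<And>t. peval p (\<chi> k. \<i> * complex_of_real (v $ k)) t = 0"
  shows "Dp p (character_delta v) = (\<lambda>_. 0)"
proof
  fix \<phi> :: "(real^'n) \<times> real \<Rightarrow> complex"
  show "Dp p (character_delta v) \<phi> = 0"
  proof (cases "test_fun \<phi>")
    case True
    define C where "C \<alpha> = Poly_Mapping.lookup p \<alpha> * (\<Prod>k\<in>UNIV. (\<i> * complex_of_real (v $ k)) ^ fst \<alpha> k)" for \<alpha>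
    define U where "U j = (-1) ^ j * character_delta v (iterpd (replicate j (0, 1)) \<phi>)" for j
    define q where "q = (\<Sum>\<alpha>\<in>Poly_Mapping.keys p. monom (C \<alpha>) (snd \<alpha>))"
    have "poly q t = peval p (\<chi> k. \<i> * complex_of_real (v $ k)) t" for t
      unfolding q_def peval_def poly_sum poly_monom C_def by simp
    then have "q = 0" using assms poly_all_0_iff_0[of q] by simp
    have "(-1) ^ sum (fst \<alpha>) UNIV * (\<Prod>k\<in>UNIV. (- (\<i> * complex_of_real (v $ k))) ^ fst \<alpha> k) = (\<Prod>k\<in>UNIV. (\<i> * complex_of_real (v $ k)) ^ fst \<alpha> k)" for \<alpha> :: "('n \<Rightarrow> nat) \<times> nat"
      by (simp add: power_sum power_minus[of "\<i> * _"] flip: prod.distrib)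
    moreover have "character_delta v (pderiv_xt \<alpha> \<phi>) = (\<Prod>k\<in>UNIV. (- (\<i> * complex_of_real (v $ k))) ^ fst \<alpha> k) *
        character_delta v (iterpd (replicate (snd \<alpha>) (0, 1)) \<phi>)" for \<alpha>
      by (rule pderiv_xt_functional[OF character_delta_dirderiv True])
    ultimately have "Poly_Mapping.lookup p \<alpha> * (-1) ^ (sum (fst \<alpha>) UNIV + snd \<alpha>) * character_delta v (pderiv_xt \<alpha> \<phi>) = C \<alpha> * U (snd \<alpha>)" for \<alpha>
      by (simp add: C_def U_def power_add mult_ac)
    then have "Dp p (character_delta v) \<phi> = (\<Sum>\<alpha>\<in>Poly_Mapping.keys p. C \<alpha> * U (snd \<alpha>))"
      using True by (simp add: Dp_def)
    also have "\<dots> = (\<Sum>j\<le>degree q. coeff q j * U j)"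
      unfolding q_def by (rule sum_monom_functional[symmetric]) simp
    also have "\<dots> = 0" using \<open>q = 0\<close> by simp
    finally show ?thesis .
  qed (simp add: Dp_def)
qed

lemma smooth_cis: "smooth_fun (\<lambda>t::real. cis (c * t))"
proof (rule smooth_coinduct[where P="\<lambda>h. \<exists>k. h = (\<lambda>t. k * cis (c * t))"])
  show "\<exists>k. (\<lambda>t. cis (c * t)) = (\<lambda>t. k * cis (c * t))" by (rule exI[of _ 1]) simp
  show "continuous_on UNIV h" if "\<exists>k. h = (\<lambda>t. k * cis (c * t))" for h :: "real \<Rightarrow> complex"
    using that by (auto simp: cis_conv_exp intro!: continuous_intros)
  fix h :: "real \<Rightarrow> complex" and v :: real
  assume "\<exists>k. h = (\<lambda>t. k * cis (c * t))" and "v \<in> Basis"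
  then obtain k where h: "h = (\<lambda>t. k * cis (c * t))" and v: "v = 1" by auto
  have "has_dirderiv 1 (\<lambda>t. cis (c * t)) (\<lambda>t. \<i> * complex_of_real c * cis (c * t))"
    by (rule has_dirderiv_character) (simp add: cis_mult algebra_simps)
  from has_dirderiv_cmult[OF this, of k]
  have "has_dirderiv v h (\<lambda>t. (k * (\<i> * complex_of_real c)) * cis (c * t))"
    by (simp add: h v mult.assoc)
  then show "\<exists>h'. has_dirderiv v h h' \<and> (\<exists>k. h' = (\<lambda>t. k * cis (c * t)))" by blast
qed

lemma smooth_prod: "finite I \<Longrightarrow> (\<And>i. i \<in> I \<Longrightarrow> smooth_fun (f i)) \<Longrightarrow> smooth_fun (\<lambda>x. \<Prod>i\<in>I. f i x)"
  by (induction I rule: finite_induct) (auto intro: smooth_const smooth_mult)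

lemma character_delta_nonzero:
  fixes v :: "real^'n::finite"
  shows "character_delta v \<noteq> (\<lambda>_. 0)"
proof
  assume zero: "character_delta v = (\<lambda>_. 0)"
  obtain b :: "real \<Rightarrow> real" where b: "smooth_fun (\<lambda>t. complex_of_real (b t))" "continuous_on UNIV b"
    "\<And>t. b t \<ge> 0" "\<And>t. t \<notin> {0..1} \<Longrightarrow> b t = 0" "\<And>t. t \<in> {0<..<1} \<Longrightarrow> b t > 0" "integral {0..1} b = 1"
    using bump_exists by blast
  \<comment> \<open>The phase is opposite to that of the character, so the integrand becomes the
    nonnegative function \<open>b (1 / 2) * W x\<close>.\<close>
  define \<psi> where "\<psi> x = (\<Prod>k\<in>UNIV. complex_of_real (b (x $ k)) * cis (- v $ k * x $ k))" for x :: "real^'n"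
  \<comment> \<open>Shifted so that time 0 meets the positive value
    \<open>b (1 / 2)\<close>.\<close>
  define \<phi> where "\<phi> t = complex_of_real (b (t + 1 / 2))" for t
  have "smooth_fun \<psi>"
    unfolding \<psi>_def
  proof (rule smooth_prod)
    fix k :: 'n
    show "smooth_fun (\<lambda>x :: real^'n. complex_of_real (b (x $ k)) * cis (- v $ k * x $ k))"
    proof (rule smooth_pullback[where L="\<lambda>x. x $ k"])
      show "smooth_fun (\<lambda>t. complex_of_real (b t) * cis (- v $ k * t))" by (intro smooth_mult b(1) smooth_cis)
      show "linear (\<lambda>x :: real^'n. x $ k)" by (simp add: bounded_linear.linear bounded_linear_vec_nth)
      show "w $ k \<in> insert 0 Basis" if "w \<in> Basis" for w :: "real^'n"
        using that by (auto simp: Basis_vec_def axis_def)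
    qed
  qed simp
  moreover have "\<psi> x = 0" if "norm x > real CARD('n)" for x
  proof (rule ccontr)
    assume "\<psi> x \<noteq> 0"
    then have "b (x $ k) \<noteq> 0" for k by (simp add: \<psi>_def)
    then have "\<bar>x $ k\<bar> \<le> 1" for k using b(4)[of "x $ k"] by fastforce
    then have "norm x \<le> (\<Sum>k\<in>(UNIV :: 'n set). 1)" by (intro order_trans[OF norm_le_l1_cart] sum_mono) auto
    then show False using that by simp
  qed
  ultimately have \<psi>: "test_fun \<psi>" unfolding test_fun_iff by blast
  have "\<forall>t. norm t > 1 \<longrightarrow> complex_of_real (b t) = 0"
  proof (intro allI impI)
    fix t :: real assume "norm t > 1"
    then have "t \<notin> {0..1}" by auto
    then show "complex_of_real (b t) = 0" using b(4) by simp
  qed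
  then have "test_fun (\<lambda>t. complex_of_real (b t))" unfolding test_fun_iff using b(1) by blast
  then have \<phi>: "test_fun \<phi>" unfolding \<phi>_def by (rule test_translate)
  define W where "W x = (\<Prod>k\<in>UNIV. b (x $ k))" for x :: "real^'n"
  have test: "test_fun (\<lambda>(x, t). \<psi> x * \<phi> t)" by (rule test_tensor[OF \<psi> \<phi>])
  have prod_cis: "(\<Prod>k\<in>I. cis (f k)) = cis (\<Sum>k\<in>I. f k)" for I and f :: "'n \<Rightarrow> real"
    by (induction I rule: infinite_finite_induct) (auto simp: cis_mult)
  have eq: "cis (v \<bullet> x) * (\<lambda>(x, t). \<psi> x * \<phi> t) (x, 0) = complex_of_real (b (1 / 2) * W x)" for x
  proof -
    have "(\<Prod>k\<in>UNIV. cis (- v $ k * x $ k)) = cis (- (v \<bullet> x))"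
      unfolding prod_cis by (simp add: inner_vec_def sum_negf)
    then have "\<psi> x = complex_of_real (W x) * cis (- (v \<bullet> x))"
      by (simp add: \<psi>_def W_def prod.distrib)
    moreover have "cis (v \<bullet> x) * cis (- (v \<bullet> x)) = 1" by (simp add: cis_mult)
    ultimately show ?thesis by (simp add: \<phi>_def mult_ac)
  qed
  have "integrable lborel (\<lambda>x. complex_of_real (b (1 / 2) * W x))"
    using character_slice(2)[OF test, of v] unfolding eq .
  then have int: "integrable lborel (\<lambda>x. b (1 / 2) * W x)" using integrable_Re by force
  have "(\<integral>x. complex_of_real (b (1 / 2) * W x) \<partial>lborel) = 0"
    using fun_cong[OF zero, of "\<lambda>(x, t). \<psi> x * \<phi> t"] test unfolding character_delta_def eq by simp
  then have "complex_of_real (\<integral>x. b (1 / 2) * W x \<partial>lborel) = 0"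
    by (simp only: integral_complex_of_real)
  then have "(\<integral>x. b (1 / 2) * W x \<partial>lborel) = 0" by (simp only: of_real_eq_0_iff)
  moreover have "AE x in lborel. 0 \<le> b (1 / 2) * W x" using b(3) by (simp add: W_def prod_nonneg)
  ultimately have ae: "AE x in lborel. b (1 / 2) * W x = 0"
    using integral_nonneg_eq_0_iff_AE[OF int] by blast
  define one :: "real^'n" where "one = (\<chi> k. 1)"
  have "AE x in lborel. x \<notin> box 0 one"
    using ae
  proof (rule AE_mp, intro AE_I2 impI)
    fix x :: "real^'n" assume "b (1 / 2) * W x = 0"
    moreover have "b (1 / 2) * W x > 0" if "x \<in> box 0 one"
    proof -
      have "x $ k \<in> {0<..<1}" for k
        using that by (simp add: mem_box_cart one_def)
      then show ?thesis using b(5) by (auto simp: W_def intro!: mult_pos_pos prod_pos)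
    qed
    ultimately show "x \<notin> box 0 one" by force
  qed
  then have "emeasure lborel (box 0 one) = 0"
    by (subst (asm) AE_iff_measurable[of "box 0 one"]) auto
  moreover have "one \<bullet> b = 1" if "b \<in> Basis" for b
    using that by (auto simp: Basis_vec_def one_def inner_axis)
  ultimately show False by (subst (asm) emeasure_lborel_box) auto
qed

text \<open>The condition on \<open>v\<close> makes the character invariant under all shifts
  \<open>a k\<close>, and a test function supported in negative times is 0 on the slice at time
  0.\<close>

lemma character_delta_in_kernel:
  fixes a :: "'n::finite \<Rightarrow> real^'n" and p :: "'n cpoly"
  assumes v: "\<And>k. \<exists>j::int. v \<bullet> a k = 2 * pi * of_int j"
    and p: "\<And>t. peval p (\<chi> k. \<i> * complex_of_real (v $ k)) t = 0"
  shows "character_delta v \<in> N_S a p"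
proof -
  have "character_delta v (\<lambda>(x, t). \<psi> (x + a k) * \<phi> t) = character_delta v (\<lambda>(x, t). \<psi> x * \<phi> t)"
    if \<psi>: "test_fun \<psi>" and \<phi>: "test_fun \<phi>" for \<psi> :: "real^'n \<Rightarrow> complex" and \<phi> :: "real \<Rightarrow> complex" and k
  proof -
    obtain j :: int where j: "v \<bullet> a k = 2 * pi * of_int j" using v by blast
    have "cis (- (v \<bullet> a k)) = cis (2 * pi * of_int (- j))" by (simp add: j)
    also have "\<dots> = 1" by (rule cis_multiple_2pi) simp
    finally show ?thesis
      using character_delta_translate[OF test_tensor[OF \<psi> \<phi>], of v "a k"]
      by (simp add: case_prod_unfold)
  qed
  moreover have "character_delta v \<phi> = 0" if "closure {y. \<phi> y \<noteq> 0} \<subseteq> {(x, t). t < 0}" for \<phi>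
  proof -
    have "\<phi> (x, 0) = 0" for x using that closure_subset[of "{y. \<phi> y \<noteq> 0}"] by fastforce
    then show ?thesis by (simp add: character_delta_def)
  qed
  ultimately show ?thesis
    using character_delta_distribution character_delta_Dp[OF p]
    by (simp add: N_S_def periodic_dist_def vanishes_neg_time_def)
qed

lemma zero_in_kernel: "(\<lambda>_. 0) \<in> N_S a p"
  by (auto simp: N_S_def periodic_dist_def vanishes_neg_time_def distribution_def Dp_def)

theorem theorem6p1:
  fixes a :: "'n::finite \<Rightarrow> real^'n" and p :: "'n cpoly"
  assumes "inj a" and "independent (range a)"
  defines "A \<equiv> (\<chi> k. a k) :: real^'n^'n"
  shows "N_S a p = {\<lambda>_. 0} \<longleftrightarrow>
    (\<forall>v \<in> (\<lambda>m. matrix_inv A *v ((2 * pi) *\<^sub>R m)) ` {m :: real^'n. \<forall>k. m $ k \<in> \<int>}.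
       \<exists>t :: complex. peval p (\<chi> k. \<i> * complex_of_real (v $ k)) t \<noteq> 0)"
proof
  assume triv: "N_S a p = {\<lambda>_. 0}"
  show "\<forall>v \<in> (\<lambda>m. matrix_inv A *v ((2 * pi) *\<^sub>R m)) ` {m :: real^'n. \<forall>k. m $ k \<in> \<int>}.
       \<exists>t :: complex. peval p (\<chi> k. \<i> * complex_of_real (v $ k)) t \<noteq> 0"
  proof (safe, rule ccontr)
    fix m :: "real^'n"
    define v where "v = matrix_inv A *v ((2 * pi) *\<^sub>R m)"
    assume m: "\<forall>k. m $ k \<in> \<int>"
      and "\<nexists>t. peval p (\<chi> k. \<i> * complex_of_real ((matrix_inv A *v ((2 * pi) *\<^sub>R m)) $ k)) t \<noteq> 0"
    then have p: "peval p (\<chi> k. \<i> * complex_of_real (v $ k)) t = 0" for t by (simp add: v_def)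
    \<comment> \<open>Integrality of \<open>m\<close> enters here: \<open>v\<close> pairs with
      \<open>a k\<close> to \<open>2 pi\<close> times the \<open>k\<close>-th entry of
      \<open>m\<close>.\<close>
    have "\<exists>j::int. v \<bullet> a k = 2 * pi * of_int j" for k
      using inner_matrix_inv[OF assms(1,2), of k "(2 * pi) *\<^sub>R m"] m[rule_format, of k]
      by (auto simp: v_def A_def inner_commute elim!: Ints_cases)
    then have "character_delta v \<in> N_S a p" using p by (rule character_delta_in_kernel)
    then show False using triv character_delta_nonzero by blast
  qed
next
  assume nz: "\<forall>v \<in> (\<lambda>m. matrix_inv A *v ((2 * pi) *\<^sub>R m)) ` {m :: real^'n. \<forall>k. m $ k \<in> \<int>}.
       \<exists>t :: complex. peval p (\<chi> k. \<i> * complex_of_real (v $ k)) t \<noteq> 0"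
  have "u = (\<lambda>_. 0)" if "u \<in> N_S a p" for u
    using that nz by (intro kernel_trivial[OF assms(1,2)]) (auto simp: A_def)
  then show "N_S a p = {\<lambda>_. 0}" using zero_in_kernel by blast
qed

end
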